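(* Let $p$ be a prime, let $H$ and $K$ be finite $p$-groups, let $A\leqslant H$ and $B\leqslant K$ be subgroups and let $\varphi:A\to B$ be an isomorphism. Let $G=\bigl(H*K;\ A=B,\ \varphi\bigr)$ be the free product of $H$ and $K$ with subgroups $A$ and $B$ amalgamated via $\varphi$. Then $G$ is a conjugacy $p$-separable group if and only if $G$ is residually a finite $p$-group.
   Context: $\bigl(H*K;\ A=B,\ \varphi\bigr)$ denotes the generalized free product (amalgamated free product) obtained from the free product $H*K$ by adding the relations $a=a\varphi$ for all $a\in A$. A group $G$ is conjugacy $p$-separable if whenever elements $a,b\in G$ are not conjugate in $G$, there is a homomorphism $\psi$ of $G$ onto a finite $p$-group $X$ such that $a\psi$ and $b\psi$ are not conjugate in $X$. A group is residually a finite $p$-group if for every nontrivial element there is a homomorphism onto a finite $p$-group not sending it to $1$. *)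

theory Defs
  imports "HOL-Algebra.Algebra"
begin

definition finite_p_group :: "nat \<Rightarrow> ('a, 'b) monoid_scheme \<Rightarrow> bool" where
  "finite_p_group p Q \<longleftrightarrow> group Q \<and> finite (carrier Q) \<and> (\<exists>n. card (carrier Q) = p ^ n)"

definition conjugate_in :: "('a, 'b) monoid_scheme \<Rightarrow> 'a \<Rightarrow> 'a \<Rightarrow> bool" where
  "conjugate_in G a b \<longleftrightarrow> (\<exists>g\<in>carrier G. b = inv\<^bsub>G\<^esub> g \<otimes>\<^bsub>G\<^esub> a \<otimes>\<^bsub>G\<^esub> g)"

text \<open>Finite quotients (images) of G are represented by groups whose elements are
  sets of elements of G; every homomorphic image of G is isomorphic to such a group
  (namely G Mod ker).\<close>
definition conjugacy_p_separable :: "nat \<Rightarrow> ('a, 'b) monoid_scheme \<Rightarrow> bool" where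
  "conjugacy_p_separable p G \<longleftrightarrow>
     (\<forall>a\<in>carrier G. \<forall>b\<in>carrier G. \<not> conjugate_in G a b \<longrightarrow>
        (\<exists>(Q :: 'a set monoid) \<psi>. finite_p_group p Q \<and> \<psi> \<in> hom G Q \<and>
            \<psi> ` carrier G = carrier Q \<and> \<not> conjugate_in Q (\<psi> a) (\<psi> b)))"

definition residually_p :: "nat \<Rightarrow> ('a, 'b) monoid_scheme \<Rightarrow> bool" where
  "residually_p p G \<longleftrightarrow>
     (\<forall>g\<in>carrier G. g \<noteq> \<one>\<^bsub>G\<^esub> \<longrightarrow>
        (\<exists>(Q :: 'a set monoid) \<psi>. finite_p_group p Q \<and> \<psi> \<in> hom G Q \<and>
            \<psi> ` carrier G = carrier Q \<and> \<psi> g \<noteq> \<one>\<^bsub>Q\<^esub>))"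

definition amal_letters :: "('h, 'x) monoid_scheme \<Rightarrow> ('k, 'y) monoid_scheme \<Rightarrow> ('h + 'k) set" where
  "amal_letters H K = Inl ` carrier H \<union> Inr ` carrier K"

inductive_set amal_rel ::
  "('h, 'x) monoid_scheme \<Rightarrow> ('k, 'y) monoid_scheme \<Rightarrow> 'h set \<Rightarrow> ('h \<Rightarrow> 'k)
     \<Rightarrow> (('h + 'k) list \<times> ('h + 'k) list) set"
  for H K A \<phi> where
  refl: "w \<in> lists (amal_letters H K) \<Longrightarrow> (w, w) \<in> amal_rel H K A \<phi>"
| sym: "(u, v) \<in> amal_rel H K A \<phi> \<Longrightarrow> (v, u) \<in> amal_rel H K A \<phi>"
| trans: "(u, v) \<in> amal_rel H K A \<phi> \<Longrightarrow> (v, w) \<in> amal_rel H K A \<phi> \<Longrightarrow> (u, w) \<in> amal_rel H K A \<phi>"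
| ctxt: "(u, v) \<in> amal_rel H K A \<phi> \<Longrightarrow> x \<in> lists (amal_letters H K) \<Longrightarrow> y \<in> lists (amal_letters H K)
          \<Longrightarrow> (x @ u @ y, x @ v @ y) \<in> amal_rel H K A \<phi>"
| multH: "h1 \<in> carrier H \<Longrightarrow> h2 \<in> carrier H \<Longrightarrow>
          ([Inl h1, Inl h2], [Inl (h1 \<otimes>\<^bsub>H\<^esub> h2)]) \<in> amal_rel H K A \<phi>"
| multK: "k1 \<in> carrier K \<Longrightarrow> k2 \<in> carrier K \<Longrightarrow>
          ([Inr k1, Inr k2], [Inr (k1 \<otimes>\<^bsub>K\<^esub> k2)]) \<in> amal_rel H K A \<phi>"
| oneH: "([Inl \<one>\<^bsub>H\<^esub>], []) \<in> amal_rel H K A \<phi>"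
| oneK: "([Inr \<one>\<^bsub>K\<^esub>], []) \<in> amal_rel H K A \<phi>"
| amal: "a \<in> A \<Longrightarrow> ([Inl a], [Inr (\<phi> a)]) \<in> amal_rel H K A \<phi>"

definition amalgamated_product ::
  "('h, 'x) monoid_scheme \<Rightarrow> ('k, 'y) monoid_scheme \<Rightarrow> 'h set \<Rightarrow> ('h \<Rightarrow> 'k)
     \<Rightarrow> ('h + 'k) list set monoid" where
  "amalgamated_product H K A \<phi> =
     \<lparr> carrier = lists (amal_letters H K) // amal_rel H K A \<phi>,
       monoid.mult = (\<lambda>U V. \<Union>u\<in>U. \<Union>v\<in>V. amal_rel H K A \<phi> `` {u @ v}),
       one = amal_rel H K A \<phi> `` {[]} \<rparr>"

end

theory Submission
  imports Defs
begin

text \<open>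
  A nontrivial element is not conjugate to \<open>1\<close>, which gives one direction. For the other let \<open>\<pi>\<close> map
  the amalgamated product \<open>G\<close> to a finite p-group \<open>V\<close>. Recording, besides \<open>\<pi> g\<close>, the 1-chain \<open>D g\<close> of the
  path from a base vertex to its \<open>g\<close>-translate in the quotient of the Bass-Serre tree by the kernel of
  \<open>\<pi>\<close>, with coefficients modulo a power of \<open>p\<close>, maps \<open>G\<close> to a wreath product that is again a finite
  p-group. Residual p-finiteness provides a \<open>\<pi>\<close> that keeps any given finite set of nontrivial elements
  nontrivial, and it remains to separate \<open>a\<close> from \<open>b\<close> in such a wreath product.

  Let \<open>a\<close> and \<open>b\<close> lie in the factors and let \<open>\<pi>\<close> be injective on the factors. If \<open>g\<close> conjugates the
  images, then \<open>D g\<close>, corrected by the positions of \<open>a\<close> and \<open>b\<close>, is an \<open>a\<close>-invariant chain modulo \<open>p\<close>.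
  As \<open>a\<close>-orbits of edges that are not fixed have length divisible by \<open>p\<close>, the ends of the chain are joined
  by edges fixed by \<open>a\<close>; such a path lifts to the tree and shows that \<open>a\<close> and \<open>b\<close> are conjugate.

  Otherwise let \<open>a\<close> be cyclically reduced of length at least two, let \<open>n\<close> be the exponent of \<open>V\<close>, and
  let \<open>\<pi>\<close> keep nontrivial the commutators of \<open>a\<close> with those \<open>u \<alpha>\<close> where \<open>u\<close> is a prefix of \<open>a\<close> of odd
  length and \<open>\<alpha>\<close> is in the amalgamated subgroup. Then the path of \<open>a\<^sup>n\<close> runs through the base edge in one
  direction only, so this edge has a nonzero coefficient in \<open>D (a\<^sup>n)\<close>. If \<open>g\<close> conjugates the images, the
  translate of the base edge by the inverse of \<open>g\<close> therefore lies on the path of \<open>b\<^sup>n\<close>. This leaves, up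
  to powers of \<open>b\<close> and the kernel, only finitely many \<open>g\<close>, none of which conjugates \<open>b\<close> to \<open>a\<close> if \<open>\<pi>\<close> is
  chosen suitably.
\<close>

subsection \<open>Finite p-quotients\<close>

lemma conjugate_in_refl:
  assumes "group G" "a \<in> carrier G"
  shows "conjugate_in G a a"
proof -
  interpret group G by fact
  show ?thesis unfolding conjugate_in_def using assms(2) by (intro bexI[of _ "\<one>\<^bsub>G\<^esub>"]) auto
qed

lemma conjugate_in_sym:
  assumes "group G" "a \<in> carrier G" "conjugate_in G a b"
  shows "conjugate_in G b a"
proof -
  interpret group G by fact
  from assms obtain g where g: "g \<in> carrier G" "b = inv\<^bsub>G\<^esub> g \<otimes>\<^bsub>G\<^esub> a \<otimes>\<^bsub>G\<^esub> g"
    unfolding conjugate_in_def by auto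
  have "g \<otimes>\<^bsub>G\<^esub> b = a \<otimes>\<^bsub>G\<^esub> g"
    using g assms(2) by (simp add: m_assoc[symmetric])
  then have "a = inv\<^bsub>G\<^esub> (inv\<^bsub>G\<^esub> g) \<otimes>\<^bsub>G\<^esub> b \<otimes>\<^bsub>G\<^esub> inv\<^bsub>G\<^esub> g"
    using g assms(2) by (simp add: m_assoc)
  then show ?thesis unfolding conjugate_in_def using g by blast
qed

lemma conjugate_in_trans:
  assumes "group G" "a \<in> carrier G" "conjugate_in G a b" "conjugate_in G b c"
  shows "conjugate_in G a c"
proof -
  interpret group G by fact
  from assms obtain g h where g: "g \<in> carrier G" "b = inv\<^bsub>G\<^esub> g \<otimes>\<^bsub>G\<^esub> a \<otimes>\<^bsub>G\<^esub> g"
    and h: "h \<in> carrier G" "c = inv\<^bsub>G\<^esub> h \<otimes>\<^bsub>G\<^esub> b \<otimes>\<^bsub>G\<^esub> h"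
    unfolding conjugate_in_def by auto
  have "c = inv\<^bsub>G\<^esub> (g \<otimes>\<^bsub>G\<^esub> h) \<otimes>\<^bsub>G\<^esub> a \<otimes>\<^bsub>G\<^esub> (g \<otimes>\<^bsub>G\<^esub> h)"
    using g h assms(2) by (simp add: m_assoc inv_mult_group)
  then show ?thesis unfolding conjugate_in_def using g h by blast
qed

lemma conjugate_in_hom:
  assumes "group G" "group Q" "\<psi> \<in> hom G Q" "a \<in> carrier G" "conjugate_in G a b"
  shows "conjugate_in Q (\<psi> a) (\<psi> b)"
proof -
  interpret group_hom G Q \<psi> using assms by (simp add: group_hom_def group_hom_axioms_def)
  from assms obtain g where g: "g \<in> carrier G" "b = inv\<^bsub>G\<^esub> g \<otimes>\<^bsub>G\<^esub> a \<otimes>\<^bsub>G\<^esub> g"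
    unfolding conjugate_in_def by auto
  then have "\<psi> b = inv\<^bsub>Q\<^esub> (\<psi> g) \<otimes>\<^bsub>Q\<^esub> \<psi> a \<otimes>\<^bsub>Q\<^esub> \<psi> g" using assms(4) by simp
  then show ?thesis unfolding conjugate_in_def using g by auto
qed

lemma finite_p_group_exponent:
  assumes "finite_p_group p V"
  obtains k where "\<And>x. x \<in> carrier V \<Longrightarrow> x [^]\<^bsub>V\<^esub> (p ^ k :: nat) = \<one>\<^bsub>V\<^esub>"
proof -
  from assms interpret group V by (simp add: finite_p_group_def)
  from assms obtain k where "order V = p ^ k" by (auto simp: finite_p_group_def order_def)
  then show thesis using that pow_order_eq_1 by metis
qed

text \<open>The notions of separability speak only of quotients on sets of elements of
  \<open>G\<close>. A target \<open>W\<close> of any other type, such as a wreath product, is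
  replaced by \<open>G\<close> modulo the kernel, whose order is that of a subgroup of
  \<open>W\<close> and hence a power of \<open>p\<close>.\<close>

lemma hom_image_finite_p_quotient:
  fixes G :: "('a, 'c) monoid_scheme"
  assumes "group G" "Factorial_Ring.prime (p :: nat)" "finite_p_group p W" "\<psi> \<in> hom G W"
  obtains Q :: "'a set monoid" and \<rho> where "finite_p_group p Q" "\<rho> \<in> hom G Q"
    "\<rho> ` carrier G = carrier Q"
    "\<And>x y. x \<in> carrier G \<Longrightarrow> y \<in> carrier G \<Longrightarrow> \<rho> x = \<rho> y \<longleftrightarrow> \<psi> x = \<psi> y"
proof -
  have W: "group W" using assms by (simp add: finite_p_group_def)
  interpret group_hom G W \<psi> using assms W by (simp add: group_hom_def group_hom_axioms_def)
  let ?N = "kernel G W \<psi>"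
  let ?Q = "G Mod ?N"
  interpret N: normal ?N G by (rule normal_kernel)
  let ?\<rho> = "\<lambda>x. ?N #>\<^bsub>G\<^esub> x"
  have Qg: "group ?Q" by (rule N.factorgroup_is_group)
  have hom: "?\<rho> \<in> hom G ?Q" by (rule N.r_coset_hom_Mod)
  have surj: "?\<rho> ` carrier G = carrier ?Q" by (auto simp: FactGroup_def RCOSETS_def)
  have eq: "?\<rho> x = ?\<rho> y \<longleftrightarrow> \<psi> x = \<psi> y" if "x \<in> carrier G" "y \<in> carrier G" for x y
  proof
    assume "?\<rho> x = ?\<rho> y"
    then have "x \<in> ?N #>\<^bsub>G\<^esub> y" using that G.rcos_self[OF that(1) N.subgroup_axioms] by simp
    then obtain n where "n \<in> ?N" "x = n \<otimes>\<^bsub>G\<^esub> y" unfolding r_coset_def by blast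
    then show "\<psi> x = \<psi> y" using that unfolding kernel_def by simp
  next
    assume e: "\<psi> x = \<psi> y"
    have "x \<otimes>\<^bsub>G\<^esub> inv\<^bsub>G\<^esub> y \<in> ?N" using that e unfolding kernel_def by simp
    moreover have "x = (x \<otimes>\<^bsub>G\<^esub> inv\<^bsub>G\<^esub> y) \<otimes>\<^bsub>G\<^esub> y" using that by (simp add: G.m_assoc)
    ultimately have "x \<in> ?N #>\<^bsub>G\<^esub> y" unfolding r_coset_def by blast
    then show "?\<rho> x = ?\<rho> y" using that N.subgroup_axioms by (metis G.repr_independence)
  qed
  have img: "subgroup (\<psi> ` carrier G) W" by (rule img_is_subgroup)
  have bij: "card (carrier ?Q) = card (\<psi> ` carrier G)"
  proof -
    \<comment> \<open>A coset is sent to the common value of \<open>\<psi>\<close> on it;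
      \<open>eq\<close> gives both uniqueness of this value and injectivity.\<close>
    have "bij_betw (\<lambda>q. THE w. \<exists>x\<in>carrier G. q = ?\<rho> x \<and> w = \<psi> x) (carrier ?Q) (\<psi> ` carrier G)"
    proof -
      have the: "(THE w. \<exists>z\<in>carrier G. ?\<rho> x = ?\<rho> z \<and> w = \<psi> z) = \<psi> x" if "x \<in> carrier G" for x
        using that eq by (intro the_equality) auto
      show ?thesis unfolding surj[symmetric] bij_betw_def inj_on_def image_image
        using the eq by auto
    qed
    then show ?thesis by (rule bij_betw_same_card)
  qed
  have finW: "finite (carrier W)" using assms by (simp add: finite_p_group_def)
  have "card (\<psi> ` carrier G) dvd order W"
    using H.lagrange_finite[OF finW img] by (metis dvd_triv_right)
  moreover obtain n where "order W = p ^ n" using assms by (auto simp: finite_p_group_def order_def)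
  ultimately obtain k where k: "card (\<psi> ` carrier G) = p ^ k"
    using assms(2) divides_primepow_nat by metis
  have "finite (carrier ?Q)"
    using k bij assms(2) by (metis card.infinite power_not_zero not_prime_0)
  then have "finite_p_group p ?Q" using Qg bij k by (auto simp: finite_p_group_def)
  then show thesis using that hom surj eq by blast
qed

definition p_separated :: "nat \<Rightarrow> ('a, 'b) monoid_scheme \<Rightarrow> 'a \<Rightarrow> 'a \<Rightarrow> bool" where
  "p_separated p G a b \<longleftrightarrow>
     (\<exists>(Q :: 'a set monoid) \<psi>. finite_p_group p Q \<and> \<psi> \<in> hom G Q \<and>
        \<psi> ` carrier G = carrier Q \<and> \<not> conjugate_in Q (\<psi> a) (\<psi> b))"

text \<open>\<open>\<psi>\<close> need not be onto: in the quotient that replaces \<open>W\<close>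
  every conjugator comes from an element of \<open>G\<close>, so only the elements
  \<open>\<psi> g\<close> have to be excluded.\<close>

lemma p_separatedI:
  assumes "group G" "Factorial_Ring.prime (p :: nat)" "finite_p_group p W" "\<psi> \<in> hom G W"
    "a \<in> carrier G" "b \<in> carrier G"
    "\<And>g. g \<in> carrier G \<Longrightarrow> \<psi> (g \<otimes>\<^bsub>G\<^esub> b) \<noteq> \<psi> (a \<otimes>\<^bsub>G\<^esub> g)"
  shows "p_separated p G a b"
proof -
  interpret group G by fact
  obtain Q :: "'a set monoid" and \<rho> where Q: "finite_p_group p Q" "\<rho> \<in> hom G Q"
    "\<rho> ` carrier G = carrier Q"
    "\<And>x y. x \<in> carrier G \<Longrightarrow> y \<in> carrier G \<Longrightarrow> \<rho> x = \<rho> y \<longleftrightarrow> \<psi> x = \<psi> y"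
    by (rule hom_image_finite_p_quotient[OF assms(1-4)]) (rule that)
  have "group Q" using Q by (simp add: finite_p_group_def)
  then interpret \<rho>: group_hom G Q \<rho> using Q by (simp add: group_hom_def group_hom_axioms_def is_group)
  have "\<not> conjugate_in Q (\<rho> a) (\<rho> b)"
  proof
    assume "conjugate_in Q (\<rho> a) (\<rho> b)"
    then obtain g where g: "g \<in> carrier G" "\<rho> b = inv\<^bsub>Q\<^esub> (\<rho> g) \<otimes>\<^bsub>Q\<^esub> \<rho> a \<otimes>\<^bsub>Q\<^esub> \<rho> g"
      unfolding conjugate_in_def using Q(3) by (metis imageE)
    then have "\<rho> (g \<otimes>\<^bsub>G\<^esub> b) = \<rho> (a \<otimes>\<^bsub>G\<^esub> g)"
      using assms(5,6) by (simp add: \<rho>.H.m_assoc[symmetric])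
    then show False using Q(4)[of "g \<otimes>\<^bsub>G\<^esub> b" "a \<otimes>\<^bsub>G\<^esub> g"] assms(5,6) assms(7)[OF g(1)] g(1) by simp
  qed
  then show ?thesis unfolding p_separated_def using Q by blast
qed

lemma p_separated_sym:
  assumes "p_separated p G a b" "b \<in> carrier G"
  shows "p_separated p G b a"
proof -
  from assms(1) obtain Q :: "'a set monoid" and \<psi> where Q: "finite_p_group p Q" "\<psi> \<in> hom G Q"
    "\<psi> ` carrier G = carrier Q" "\<not> conjugate_in Q (\<psi> a) (\<psi> b)"
    unfolding p_separated_def by blast
  then have "group Q" "\<psi> b \<in> carrier Q" using assms(2) by (auto simp: finite_p_group_def)
  then have "\<not> conjugate_in Q (\<psi> b) (\<psi> a)" using Q(4) conjugate_in_sym by metis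
  then show ?thesis unfolding p_separated_def using Q by blast
qed

lemma p_separated_conjugate:
  assumes "group G" "p_separated p G a' b" "a \<in> carrier G" "b \<in> carrier G" "conjugate_in G a a'"
  shows "p_separated p G a b"
proof -
  from assms(2) obtain Q :: "'a set monoid" and \<psi> where Q: "finite_p_group p Q" "\<psi> \<in> hom G Q"
    "\<psi> ` carrier G = carrier Q" "\<not> conjugate_in Q (\<psi> a') (\<psi> b)"
    unfolding p_separated_def by blast
  have Qg: "group Q" using Q by (simp add: finite_p_group_def)
  have aQ: "\<psi> a \<in> carrier Q" using assms(3) Q by auto
  have "conjugate_in Q (\<psi> a) (\<psi> a')" using conjugate_in_hom[OF assms(1) Qg Q(2) assms(3,5)] .
  then have "conjugate_in Q (\<psi> a') (\<psi> a)" using conjugate_in_sym Qg aQ by metis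
  moreover have "\<psi> a' \<in> carrier Q"
    using \<open>conjugate_in Q (\<psi> a) (\<psi> a')\<close> Qg aQ unfolding conjugate_in_def
    by (auto intro!: monoid.m_closed group.is_monoid group.inv_closed)
  ultimately have "\<not> conjugate_in Q (\<psi> a) (\<psi> b)" using Q(4) conjugate_in_trans Qg by metis
  then show ?thesis unfolding p_separated_def using Q by blast
qed

text \<open>A map for the elements treated so far and a map that keeps one further element
  nontrivial combine into a map to the direct product, again a finite p-group.\<close>

lemma residually_p_finite_set:
  fixes G :: "('a, 'c) monoid_scheme"
  assumes "group G" "Factorial_Ring.prime (p :: nat)" "residually_p p G"
    "finite S" "S \<subseteq> carrier G"
  shows "\<exists>(V :: 'a set monoid) \<pi>. finite_p_group p V \<and> \<pi> \<in> hom G V \<and>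
           (\<forall>s\<in>S. \<pi> s = \<one>\<^bsub>V\<^esub> \<longrightarrow> s = \<one>\<^bsub>G\<^esub>)"
  using assms(4,5)
proof (induction S rule: finite_induct)
  case empty
  interpret group G by fact
  \<comment> \<open>The trivial group, realized on sets so that it has the required type.\<close>
  let ?W = "\<lparr>carrier = {{}}, monoid.mult = (\<lambda>x y. {}), one = {}\<rparr> :: 'a set monoid"
  have "group ?W" by (rule groupI) auto
  moreover have "card (carrier ?W) = p ^ 0" by simp
  ultimately have "finite_p_group p ?W" unfolding finite_p_group_def by (metis card_eq_0_iff power_0 zero_neq_one)
  moreover have "(\<lambda>_. {}) \<in> hom G ?W" by (auto simp: hom_def)
  ultimately show ?case by blast
next
  case (insert s S)
  then obtain V :: "'a set monoid" and \<pi> where V: "finite_p_group p V" "\<pi> \<in> hom G V"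
    "\<forall>s\<in>S. \<pi> s = \<one>\<^bsub>V\<^esub> \<longrightarrow> s = \<one>\<^bsub>G\<^esub>" by auto
  interpret group G by fact
  show ?case
  proof (cases "s = \<one>\<^bsub>G\<^esub>")
    case True
    then show ?thesis using V by blast
  next
    case False
    then obtain Y :: "'a set monoid" and \<rho> where Y: "finite_p_group p Y" "\<rho> \<in> hom G Y" "\<rho> s \<noteq> \<one>\<^bsub>Y\<^esub>"
      using assms(3)[unfolded residually_p_def, rule_format, of s] insert.prems by blast
    have gr: "group V" "group Y" using V Y by (auto simp: finite_p_group_def)
    obtain m n where "card (carrier V) = p ^ m" "card (carrier Y) = p ^ n"
      using V Y by (auto simp: finite_p_group_def)
    then have "card (carrier (V \<times>\<times> Y)) = p ^ (m + n)"
      by (simp add: DirProd_def card_cartesian_product power_add)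
    moreover have "finite (carrier (V \<times>\<times> Y))" using V Y by (auto simp: finite_p_group_def DirProd_def)
    ultimately have W: "finite_p_group p (V \<times>\<times> Y)"
      using gr DirProd_group unfolding finite_p_group_def by blast
    let ?\<psi> = "\<lambda>g. (\<pi> g, \<rho> g)"
    have \<psi>: "?\<psi> \<in> hom G (V \<times>\<times> Y)" using V(2) Y(2) by (auto simp: hom_def DirProd_def)
    \<comment> \<open>The direct product consists of pairs; passing to the quotient of
      \<open>G\<close> by the kernel restores the type needed for the induction.\<close>
    obtain Q :: "'a set monoid" and \<sigma> where Q: "finite_p_group p Q" "\<sigma> \<in> hom G Q"
      "\<sigma> ` carrier G = carrier Q"
      "\<And>x y. x \<in> carrier G \<Longrightarrow> y \<in> carrier G \<Longrightarrow> \<sigma> x = \<sigma> y \<longleftrightarrow> ?\<psi> x = ?\<psi> y"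
      by (rule hom_image_finite_p_quotient[OF assms(1,2) W \<psi>]) (rule that)
    have Qg: "group Q" using Q by (simp add: finite_p_group_def)
    have ones: "\<sigma> \<one>\<^bsub>G\<^esub> = \<one>\<^bsub>Q\<^esub>" "\<pi> \<one>\<^bsub>G\<^esub> = \<one>\<^bsub>V\<^esub>" "\<rho> \<one>\<^bsub>G\<^esub> = \<one>\<^bsub>Y\<^esub>"
      using hom_one[OF _ assms(1)] Q(2) V(2) Y(2) Qg gr by metis+
    have "\<forall>t\<in>insert s S. \<sigma> t = \<one>\<^bsub>Q\<^esub> \<longrightarrow> t = \<one>\<^bsub>G\<^esub>"
    proof (intro ballI impI)
      fix t assume t: "t \<in> insert s S" "\<sigma> t = \<one>\<^bsub>Q\<^esub>"
      then have "t \<in> carrier G" using insert.prems by auto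
      then have "\<pi> t = \<one>\<^bsub>V\<^esub>" "\<rho> t = \<one>\<^bsub>Y\<^esub>" using Q(4)[of t "\<one>\<^bsub>G\<^esub>"] t(2) ones by auto
      then show "t = \<one>\<^bsub>G\<^esub>" using t(1) V(3) Y(3) by auto
    qed
    then show ?thesis using Q by blast
  qed
qed

subsection \<open>Permutational wreath products\<close>

text \<open>The semidirect product of the functions from \<open>E\<close> to the integers modulo \<open>m\<close>, represented
  by \<open>{0..<m}\<close>, with a group \<open>V\<close> that acts on \<open>E\<close>.\<close>

definition wreath ::
  "int \<Rightarrow> 'e set \<Rightarrow> ('v \<Rightarrow> 'e \<Rightarrow> 'e) \<Rightarrow> 'v monoid \<Rightarrow> (('e \<Rightarrow> int) \<times> 'v) monoid" where
  "wreath m E act V =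
     \<lparr> carrier = (E \<rightarrow>\<^sub>E {0..<m}) \<times> carrier V,
       monoid.mult = (\<lambda>(c, x) (d, y). (\<lambda>e\<in>E. (c e + d (act (inv\<^bsub>V\<^esub> x) e)) mod m, x \<otimes>\<^bsub>V\<^esub> y)),
       one = (\<lambda>e\<in>E. 0, \<one>\<^bsub>V\<^esub>) \<rparr>"

locale set_action = group V for V :: "'v monoid" +
  fixes E :: "'e set" and act :: "'v \<Rightarrow> 'e \<Rightarrow> 'e"
  assumes act_closed: "x \<in> carrier V \<Longrightarrow> e \<in> E \<Longrightarrow> act x e \<in> E"
    and act_one: "e \<in> E \<Longrightarrow> act \<one>\<^bsub>V\<^esub> e = e"
    and act_mult: "x \<in> carrier V \<Longrightarrow> y \<in> carrier V \<Longrightarrow> e \<in> E \<Longrightarrow>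
                     act (x \<otimes>\<^bsub>V\<^esub> y) e = act x (act y e)"
begin

lemma act_inv_act:
  assumes "x \<in> carrier V" "e \<in> E"
  shows "act (inv\<^bsub>V\<^esub> x) (act x e) = e" "act x (act (inv\<^bsub>V\<^esub> x) e) = e"
  using act_mult[of "inv\<^bsub>V\<^esub> x" x e] act_mult[of x "inv\<^bsub>V\<^esub> x" e] act_one[of e] assms by auto

lemma wreath_group:
  assumes m: "m > 0"
  shows "group (wreath m E act V)"
proof (rule groupI)
  let ?W = "wreath m E act V"
  show "\<one>\<^bsub>?W\<^esub> \<in> carrier ?W" using m by (auto simp: wreath_def)
  show "u \<otimes>\<^bsub>?W\<^esub> v \<in> carrier ?W" if "u \<in> carrier ?W" "v \<in> carrier ?W" for u v
    using that m by (auto simp: wreath_def split: prod.splits)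
  show "u \<otimes>\<^bsub>?W\<^esub> v \<otimes>\<^bsub>?W\<^esub> w = u \<otimes>\<^bsub>?W\<^esub> (v \<otimes>\<^bsub>?W\<^esub> w)"
    if "u \<in> carrier ?W" "v \<in> carrier ?W" "w \<in> carrier ?W" for u v w
    using that
    by (auto simp: wreath_def m_assoc inv_mult_group act_mult act_closed mod_simps add.assoc
        intro!: restrict_ext)
  show "\<one>\<^bsub>?W\<^esub> \<otimes>\<^bsub>?W\<^esub> u = u" if u: "u \<in> carrier ?W" for u
  proof -
    obtain c x where cx: "u = (c, x)" "c \<in> E \<rightarrow>\<^sub>E {0..<m}" "x \<in> carrier V"
      using u by (auto simp: wreath_def)
    have "(\<lambda>e\<in>E. ((\<lambda>e\<in>E. 0) e + c (act (inv\<^bsub>V\<^esub> \<one>\<^bsub>V\<^esub>) e)) mod m) = c"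
      using cx(2) by (intro extensionalityI[of _ E]) (auto simp: act_one PiE_iff)
    then show ?thesis using cx by (simp add: wreath_def)
  qed
  show "\<exists>v\<in>carrier ?W. v \<otimes>\<^bsub>?W\<^esub> u = \<one>\<^bsub>?W\<^esub>" if u: "u \<in> carrier ?W" for u
  proof -
    obtain c x where cx: "u = (c, x)" "c \<in> E \<rightarrow>\<^sub>E {0..<m}" "x \<in> carrier V"
      using u by (auto simp: wreath_def)
    \<comment> \<open>The left inverse of \<open>(c, x)\<close> carries the negative of
      \<open>c\<close>, translated by the inverse of \<open>x\<close>.\<close>
    have "(\<lambda>e\<in>E. (- c (act x e)) mod m, inv\<^bsub>V\<^esub> x) \<otimes>\<^bsub>?W\<^esub> u = \<one>\<^bsub>?W\<^esub>"
      using cx by (auto simp: wreath_def mod_simps intro!: restrict_ext)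
    moreover have "(\<lambda>e\<in>E. (- c (act x e)) mod m, inv\<^bsub>V\<^esub> x) \<in> carrier ?W"
      using cx m by (auto simp: wreath_def)
    ultimately show ?thesis by blast
  qed
qed

lemma wreath_finite_p_group:
  assumes "finite_p_group p V" "finite E" "p > 0"
  shows "finite_p_group p (wreath (int (p ^ k)) E act V)"
proof -
  let ?W = "wreath (int (p ^ k)) E act V"
  obtain n where n: "card (carrier V) = p ^ n" "finite (carrier V)"
    using assms by (auto simp: finite_p_group_def)
  have "card (carrier ?W) = (p ^ k) ^ card E * p ^ n"
    using n assms(2) by (simp add: wreath_def card_cartesian_product card_PiE nat_power_eq)
  also have "\<dots> = p ^ (k * card E + n)" by (simp add: power_mult power_add)
  finally have "card (carrier ?W) = p ^ (k * card E + n)" .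
  moreover have "finite (carrier ?W)" using n assms(2) by (auto simp: wreath_def intro!: finite_PiE)
  moreover have "group ?W" using assms(3) by (intro wreath_group) simp
  ultimately show ?thesis unfolding finite_p_group_def by blast
qed

text \<open>The hypothesis on \<open>d\<close> is that of a crossed homomorphism, with
  \<open>G\<close> acting on functions through \<open>\<pi>\<close>; paired with
  \<open>\<pi>\<close> it becomes a homomorphism to the semidirect product.\<close>

lemma wreath_homI:
  fixes d :: "'g \<Rightarrow> 'e \<Rightarrow> int"
  assumes m: "m > 0" and \<pi>: "\<pi> \<in> hom G V"
    and d: "\<And>g h e. g \<in> carrier G \<Longrightarrow> h \<in> carrier G \<Longrightarrow> e \<in> E \<Longrightarrow>
              d (g \<otimes>\<^bsub>G\<^esub> h) e = d g e + d h (act (inv\<^bsub>V\<^esub> \<pi> g) e)"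
  shows "(\<lambda>g. (\<lambda>e\<in>E. d g e mod m, \<pi> g)) \<in> hom G (wreath m E act V)"
proof (rule homI)
  fix g assume "g \<in> carrier G"
  then show "(\<lambda>e\<in>E. d g e mod m, \<pi> g) \<in> carrier (wreath m E act V)"
    using m \<pi> by (auto simp: wreath_def hom_def)
next
  fix g h assume gh: "g \<in> carrier G" "h \<in> carrier G"
  then have "\<pi> g \<in> carrier V" using \<pi> by (auto simp: hom_def)
  then show "(\<lambda>e\<in>E. d (g \<otimes>\<^bsub>G\<^esub> h) e mod m, \<pi> (g \<otimes>\<^bsub>G\<^esub> h)) =
    (\<lambda>e\<in>E. d g e mod m, \<pi> g) \<otimes>\<^bsub>wreath m E act V\<^esub> (\<lambda>e\<in>E. d h e mod m, \<pi> h)"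
    using gh \<pi> by (auto simp: wreath_def d hom_mult act_closed mod_simps intro!: restrict_ext)
qed

end

section \<open>Sums over orbits of p-power length\<close>

text \<open>Orbits of \<open>\<sigma>\<close> have p-power length. On an orbit of length greater
  than one the constant value of \<open>f\<close> is counted a multiple of \<open>p\<close> times,
  and fixed points contribute zero. The induction removes one orbit at a time.\<close>

lemma funpow_dvd_sum:
  fixes f :: "'e \<Rightarrow> int" and p k :: nat
  assumes "Factorial_Ring.prime p" "finite S"
    "\<And>e. e \<in> S \<Longrightarrow> \<sigma> e \<in> S" "\<And>e. e \<in> S \<Longrightarrow> (\<sigma> ^^ (p ^ k)) e = e"
    "\<And>e. e \<in> S \<Longrightarrow> f (\<sigma> e) = f e" "\<And>e. e \<in> S \<Longrightarrow> \<sigma> e = e \<Longrightarrow> f e = 0"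
  shows "int p dvd sum f S"
  using assms(2-)
proof (induction "card S" arbitrary: S rule: less_induct)
  case less
  show ?case
  proof (cases "S = {}")
    case False
    then obtain e where e: "e \<in> S" by blast
    \<comment> \<open>The length of the orbit of \<open>e\<close>.\<close>
    define r where "r = (LEAST r. r > 0 \<and> (\<sigma> ^^ r) e = e)"
    have pk: "p ^ k > 0" using assms(1) by (simp add: prime_gt_0_nat)
    have r: "r > 0" "(\<sigma> ^^ r) e = e"
      using LeastI[of "\<lambda>r. r > 0 \<and> (\<sigma> ^^ r) e = e", OF conjI[OF pk less.prems(3)[OF e]]]
      by (auto simp: r_def)
    have least: "\<not> (0 < i \<and> (\<sigma> ^^ i) e = e)" if "i < r" for i
      using that not_less_Least unfolding r_def by blast
    have mr: "(\<sigma> ^^ (j * r)) e = e" for j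
      by (induction j) (use r(2) in \<open>simp_all add: funpow_add\<close>)
    have modr: "(\<sigma> ^^ i) e = (\<sigma> ^^ (i mod r)) e" for i
    proof -
      have "(\<sigma> ^^ i) e = (\<sigma> ^^ (i mod r)) ((\<sigma> ^^ (i div r * r)) e)"
        by (metis add.commute comp_apply div_mult_mod_eq funpow_add)
      then show ?thesis by (simp add: mr)
    qed
    have mem: "(\<sigma> ^^ i) e \<in> S" for i
      by (induction i) (use e less.prems(2) in auto)
    have fi: "f ((\<sigma> ^^ i) e) = f e" for i
      by (induction i) (use mem less.prems(4) in auto)
    have inj: "inj_on (\<lambda>i. (\<sigma> ^^ i) e) {..<r}"
    proof (rule linorder_inj_onI')
      fix i j assume ij: "i \<in> {..<r}" "j \<in> {..<r}" "i < j"
      show "(\<sigma> ^^ i) e \<noteq> (\<sigma> ^^ j) e"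
      proof
        assume "(\<sigma> ^^ i) e = (\<sigma> ^^ j) e"
        then have "(\<sigma> ^^ (r - j)) ((\<sigma> ^^ i) e) = (\<sigma> ^^ (r - j)) ((\<sigma> ^^ j) e)" by simp
        then have "(\<sigma> ^^ (r - j + i)) e = (\<sigma> ^^ (r - j + j)) e" by (simp only: funpow_add comp_apply)
        then have "(\<sigma> ^^ (r - j + i)) e = e" using ij r by simp
        then show False using least[of "r - j + i"] ij by auto
      qed
    qed
    define O' where "O' = (\<lambda>i. (\<sigma> ^^ i) e) ` {..<r}"
    have O_mem: "(\<sigma> ^^ i) e \<in> O'" for i
      using modr[of i] r(1) unfolding O'_def by (metis imageI lessThan_iff mod_less_divisor)
    have O_sub: "O' \<subseteq> S" using mem by (auto simp: O'_def)
    have sumO: "sum f O' = int r * f e"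
      unfolding O'_def by (subst sum.reindex[OF inj]) (simp add: fi)
    have "r dvd p ^ k"
    proof -
      have "(\<sigma> ^^ (p ^ k mod r)) e = e" using modr[of "p ^ k"] less.prems(3)[OF e] by simp
      then have "p ^ k mod r = 0" using least[of "p ^ k mod r"] r(1) by auto
      then show ?thesis by auto
    qed
    then obtain j where j: "r = p ^ j" using assms(1) divides_primepow_nat by blast
    have dO: "int p dvd sum f O'"
    proof (cases "j = 0")
      case True
      then have "\<sigma> e = e" using r(2) j by simp
      then show ?thesis using less.prems(5)[OF e] sumO by simp
    next
      case False
      then show ?thesis using sumO j by (simp add: dvd_power)
    qed
    have e_O: "e \<in> O'" using O_mem[of 0] by simp
    have "int p dvd sum f (S - O')"
    proof (rule less.hyps)
      show "card (S - O') < card S"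
        using e e_O less.prems(1) by (intro psubset_card_mono) auto
      show "\<sigma> x \<in> S - O'" if x: "x \<in> S - O'" for x
      proof -
        have "\<sigma> x \<notin> O'"
        proof
          assume "\<sigma> x \<in> O'"
          then obtain i where i: "\<sigma> x = (\<sigma> ^^ i) e" by (auto simp: O'_def)
          \<comment> \<open>The power \<open>p ^ k - 1\<close> of \<open>\<sigma>\<close> undoes
            \<open>\<sigma>\<close>, so a point that is mapped into the orbit already lies in
            it.\<close>
          have "x = (\<sigma> ^^ (p ^ k - 1 + 1)) x" using less.prems(3)[of x] x pk by simp
          also have "\<dots> = (\<sigma> ^^ (p ^ k - 1)) (\<sigma> x)" by (simp only: funpow_add comp_apply) simp
          also have "\<dots> = (\<sigma> ^^ (p ^ k - 1 + i)) e" by (simp add: i funpow_add)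
          finally show False using O_mem x by auto
        qed
        then show ?thesis using x less.prems(2) by auto
      qed
    qed (use less.prems in auto)
    then show ?thesis
      using dO sum.subset_diff[OF O_sub less.prems(1), of f] by (simp add: dvd_add)
  qed simp
qed

lemma (in set_action) p_dvd_sum_invariant:
  fixes f :: "'e \<Rightarrow> int"
  assumes "Factorial_Ring.prime p" "finite_p_group p V" "finite E" "x \<in> carrier V"
    "\<And>e. e \<in> E \<Longrightarrow> f (act x e) = f e" "\<And>e. e \<in> E \<Longrightarrow> act x e = e \<Longrightarrow> f e = 0"
  shows "int p dvd sum f E"
proof -
  obtain k where k: "x [^]\<^bsub>V\<^esub> (p ^ k :: nat) = \<one>\<^bsub>V\<^esub>"
    using finite_p_group_exponent[OF assms(2)] assms(4) by metis
  have pow: "(act x ^^ n) e = act (x [^]\<^bsub>V\<^esub> n) e" if "e \<in> E" for n e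
    by (induction n) (use that assms(4) in \<open>simp_all add: act_one act_mult[symmetric] nat_pow_Suc2[symmetric]\<close>)
  show ?thesis
    by (rule funpow_dvd_sum[where \<sigma> = "act x" and k = k])
      (use assms act_closed pow k act_one in auto)
qed

subsection \<open>Normal forms in amalgamated products\<close>

text \<open>Elements of the amalgamated product act on pairs of an element of the amalgamated subgroup
  and an alternating list of representatives of its nontrivial right cosets in the two factors.
  The following locale describes how one factor \<open>M\<close> acts, where \<open>C\<close> is the amalgamated subgroup,
  \<open>\<theta>\<close> embeds it onto \<open>S\<close> and \<open>c\<close> injects the elements of \<open>M\<close> into the letters: the pairs are
  identified with the pairs of an element of \<open>M\<close> and a list that does not begin with a letter of
  \<open>M\<close>, and \<open>M\<close> multiplies the first component.\<close>

locale factor_action = M: group M + C: group C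
  for M :: "'m monoid" and C :: "'c monoid" +
  fixes S :: "'m set" and \<theta> :: "'c \<Rightarrow> 'm" and c :: "'m \<Rightarrow> 'l"
  assumes S: "subgroup S M" and \<theta>: "\<theta> \<in> iso C (M\<lparr>carrier := S\<rparr>)" and inj_c: "inj c"
begin

text \<open>The choice refers to \<open>x\<close> only through its coset, which makes
  \<open>rep\<close> constant on right cosets.\<close>

definition rep :: "'m \<Rightarrow> 'm" where
  "rep x = (SOME t. t \<in> S #>\<^bsub>M\<^esub> x)"

text \<open>\<open>x\<close> is split as an element of \<open>S\<close> times \<open>rep x\<close>,
  and the representative becomes the new first letter; for \<open>x\<close> in \<open>S\<close> no
  letter is added. \<open>enc\<close> absorbs the letter again.\<close>

definition dec :: "'m \<times> 'l list \<Rightarrow> 'c \<times> 'l list" where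
  "dec = (\<lambda>(x, ts). if x \<in> S then (inv_into (carrier C) \<theta> x, ts)
      else (inv_into (carrier C) \<theta> (x \<otimes>\<^bsub>M\<^esub> inv\<^bsub>M\<^esub> rep x), c (rep x) # ts))"

definition enc :: "'c \<times> 'l list \<Rightarrow> 'm \<times> 'l list" where
  "enc = (\<lambda>(\<alpha>, ts). if ts \<noteq> [] \<and> hd ts \<in> range c then (\<theta> \<alpha> \<otimes>\<^bsub>M\<^esub> inv_into UNIV c (hd ts), tl ts) else (\<theta> \<alpha>, ts))"

definition act :: "'m \<Rightarrow> 'c \<times> 'l list \<Rightarrow> 'c \<times> 'l list" where
  "act m \<omega> = dec (m \<otimes>\<^bsub>M\<^esub> fst (enc \<omega>), snd (enc \<omega>))"

definition good :: "'m \<Rightarrow> bool" where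
  "good t \<longleftrightarrow> t \<in> carrier M \<and> t \<notin> S \<and> rep t = t"

definition free_of :: "'l list \<Rightarrow> bool" where
  "free_of ts \<longleftrightarrow> ts = [] \<or> hd ts \<notin> range c"

definition normal :: "'l list \<Rightarrow> bool" where
  "normal ts \<longleftrightarrow> free_of ts \<or> (\<exists>t ts'. ts = c t # ts' \<and> good t \<and> free_of ts')"

lemma S_sub: "x \<in> S \<Longrightarrow> x \<in> carrier M"
  using S by (rule subgroup.mem_carrier)

lemma \<theta>_mem: "\<alpha> \<in> carrier C \<Longrightarrow> \<theta> \<alpha> \<in> S"
  using \<theta> by (auto simp: iso_def hom_def)

lemma \<theta>_mult: "\<alpha> \<in> carrier C \<Longrightarrow> \<beta> \<in> carrier C \<Longrightarrow> \<theta> (\<alpha> \<otimes>\<^bsub>C\<^esub> \<beta>) = \<theta> \<alpha> \<otimes>\<^bsub>M\<^esub> \<theta> \<beta>"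
  using \<theta> by (auto simp: iso_def hom_def)

lemma \<theta>_bij: "bij_betw \<theta> (carrier C) S"
  using \<theta> by (auto simp: iso_def)

lemma \<theta>_inv: "x \<in> S \<Longrightarrow> \<theta> (inv_into (carrier C) \<theta> x) = x"
  using \<theta>_bij by (rule bij_betw_inv_into_right)

lemma inv_\<theta>: "\<alpha> \<in> carrier C \<Longrightarrow> inv_into (carrier C) \<theta> (\<theta> \<alpha>) = \<alpha>"
  using \<theta>_bij by (rule bij_betw_inv_into_left)

lemma inv_\<theta>_mem: "x \<in> S \<Longrightarrow> inv_into (carrier C) \<theta> x \<in> carrier C"
  using \<theta>_bij by (metis bij_betw_def inv_into_into)

lemma inv_c: "inv_into UNIV c (c t) = t"
  using inj_c by (rule inv_f_f)

lemma rep_coset: "x \<in> carrier M \<Longrightarrow> rep x \<in> S #>\<^bsub>M\<^esub> x"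
  unfolding rep_def by (rule someI) (rule M.rcos_self[OF _ S])

lemma rep_eq:
  assumes "s \<in> S" "x \<in> carrier M"
  shows "rep (s \<otimes>\<^bsub>M\<^esub> x) = rep x"
proof -
  have "s \<otimes>\<^bsub>M\<^esub> x \<in> S #>\<^bsub>M\<^esub> x" using assms unfolding r_coset_def by blast
  then have "S #>\<^bsub>M\<^esub> (s \<otimes>\<^bsub>M\<^esub> x) = S #>\<^bsub>M\<^esub> x" using M.repr_independence[OF _ assms(2) S] by simp
  then show ?thesis by (simp add: rep_def)
qed

lemma rep_props:
  assumes "x \<in> carrier M"
  shows "rep x \<in> carrier M" "x \<otimes>\<^bsub>M\<^esub> inv\<^bsub>M\<^esub> rep x \<in> S" "rep (rep x) = rep x" "x \<notin> S \<Longrightarrow> good (rep x)"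
proof -
  obtain s where s: "s \<in> S" "rep x = s \<otimes>\<^bsub>M\<^esub> x" using rep_coset[OF assms] unfolding r_coset_def by blast
  have sM: "s \<in> carrier M" "inv\<^bsub>M\<^esub> s \<in> S" using s(1) S_sub subgroup.m_inv_closed[OF S] by auto
  show 1: "rep x \<in> carrier M" using s sM assms by simp
  have "x \<otimes>\<^bsub>M\<^esub> inv\<^bsub>M\<^esub> rep x = inv\<^bsub>M\<^esub> s"
    using s sM assms by (simp add: M.inv_mult_group M.m_assoc[symmetric])
  then show "x \<otimes>\<^bsub>M\<^esub> inv\<^bsub>M\<^esub> rep x \<in> S" using sM by simp
  show 2: "rep (rep x) = rep x" using rep_eq[OF s(1) assms] s(2) by simp
  have "x = inv\<^bsub>M\<^esub> s \<otimes>\<^bsub>M\<^esub> rep x" using s sM assms by (simp add: M.m_assoc[symmetric])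
  then have "rep x \<in> S \<Longrightarrow> x \<in> S" using sM subgroup.m_closed[OF S] by metis
  then show "x \<notin> S \<Longrightarrow> good (rep x)" using 1 2 by (auto simp: good_def)
qed

lemma enc_dec:
  assumes "x \<in> carrier M" "free_of ts"
  shows "enc (dec (x, ts)) = (x, ts)"
  using assms rep_props[OF assms(1)]
  by (auto simp: dec_def enc_def free_of_def \<theta>_inv inv_c M.m_assoc)

lemma dec_form:
  assumes "x \<in> carrier M" "free_of ts"
  shows "fst (dec (x, ts)) \<in> carrier C" "normal (snd (dec (x, ts)))"
  using assms rep_props[OF assms(1)]
  by (auto simp: dec_def normal_def inv_\<theta>_mem)

lemma enc_form:
  assumes "\<alpha> \<in> carrier C" "normal ts"
  shows "fst (enc (\<alpha>, ts)) \<in> carrier M" "free_of (snd (enc (\<alpha>, ts)))"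
  using assms \<theta>_mem[OF assms(1)] S_sub
  by (auto simp: enc_def normal_def free_of_def inv_c good_def inj_eq[OF inj_c])

lemma dec_enc:
  assumes "\<alpha> \<in> carrier C" "normal ts"
  shows "dec (enc (\<alpha>, ts)) = (\<alpha>, ts)"
proof (cases "free_of ts")
  case True
  then have "enc (\<alpha>, ts) = (\<theta> \<alpha>, ts)" by (auto simp: enc_def free_of_def)
  then show ?thesis using \<theta>_mem[OF assms(1)] by (simp add: dec_def inv_\<theta> assms)
next
  case False
  then obtain t ts' where t: "ts = c t # ts'" "good t" using assms(2) by (auto simp: normal_def)
  have s: "\<theta> \<alpha> \<in> S" "\<theta> \<alpha> \<in> carrier M" using \<theta>_mem assms S_sub by auto
  have tM: "t \<in> carrier M" "t \<notin> S" "rep t = t" using t by (auto simp: good_def)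
  have "enc (\<alpha>, ts) = (\<theta> \<alpha> \<otimes>\<^bsub>M\<^esub> t, ts')" using t by (simp add: enc_def inv_c)
  moreover have "\<theta> \<alpha> \<otimes>\<^bsub>M\<^esub> t \<notin> S"
  proof
    assume "\<theta> \<alpha> \<otimes>\<^bsub>M\<^esub> t \<in> S"
    then have "inv\<^bsub>M\<^esub> (\<theta> \<alpha>) \<otimes>\<^bsub>M\<^esub> (\<theta> \<alpha> \<otimes>\<^bsub>M\<^esub> t) \<in> S"
      using s subgroup.m_closed[OF S] subgroup.m_inv_closed[OF S] by blast
    then show False using s tM by (simp add: M.m_assoc[symmetric])
  qed
  moreover have "rep (\<theta> \<alpha> \<otimes>\<^bsub>M\<^esub> t) = t" using rep_eq[OF s(1) tM(1)] tM(3) by simp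
  moreover have "\<theta> \<alpha> \<otimes>\<^bsub>M\<^esub> t \<otimes>\<^bsub>M\<^esub> inv\<^bsub>M\<^esub> t = \<theta> \<alpha>" using s tM by (simp add: M.m_assoc)
  ultimately show ?thesis using t by (simp add: dec_def inv_\<theta> assms)
qed

text \<open>The \<open>enc\<close> of the outer action cancels the \<open>dec\<close> of the inner
  one, which leaves associativity in \<open>M\<close>.\<close>

lemma act_mult:
  assumes "m \<in> carrier M" "n \<in> carrier M" "\<alpha> \<in> carrier C" "normal ts"
  shows "act (m \<otimes>\<^bsub>M\<^esub> n) (\<alpha>, ts) = act m (act n (\<alpha>, ts))"
  using assms enc_form[OF assms(3,4)] by (simp add: act_def enc_dec M.m_assoc)

lemma act_one:
  assumes "\<alpha> \<in> carrier C" "normal ts"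
  shows "act \<one>\<^bsub>M\<^esub> (\<alpha>, ts) = (\<alpha>, ts)"
  using assms enc_form[OF assms] by (simp add: act_def dec_enc)

lemma act_form:
  assumes "m \<in> carrier M" "\<alpha> \<in> carrier C" "normal ts"
  shows "fst (act m (\<alpha>, ts)) \<in> carrier C" "normal (snd (act m (\<alpha>, ts)))"
  using assms enc_form[OF assms(2,3)] dec_form by (simp_all add: act_def)

lemma act_set:
  assumes "m \<in> carrier M" "\<alpha> \<in> carrier C" "normal ts"
  obtains t where "good t" "snd (act m (\<alpha>, ts)) = c t # snd (enc (\<alpha>, ts))"
  | "snd (act m (\<alpha>, ts)) = snd (enc (\<alpha>, ts))"
proof -
  have "m \<otimes>\<^bsub>M\<^esub> fst (enc (\<alpha>, ts)) \<in> carrier M" using assms enc_form[OF assms(2,3)] by simp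
  from rep_props(4)[OF this] show thesis using that
    by (cases "m \<otimes>\<^bsub>M\<^esub> fst (enc (\<alpha>, ts)) \<in> S") (auto simp: act_def dec_def)
qed

text \<open>The right-hand side mentions neither \<open>M\<close> nor \<open>\<theta>\<close>. Hence
  the two factors act in the same way through the amalgamated subgroup, as the amalgamation relation
  demands.\<close>

lemma act_base:
  assumes "\<beta> \<in> carrier C" "\<alpha> \<in> carrier C" "normal ts"
  shows "act (\<theta> \<beta>) (\<alpha>, ts) = (\<beta> \<otimes>\<^bsub>C\<^esub> \<alpha>, ts)"
proof -
  have s: "\<theta> \<alpha> \<in> carrier M" "\<theta> \<beta> \<in> carrier M" using \<theta>_mem assms S_sub by auto
  have "(\<theta> \<beta> \<otimes>\<^bsub>M\<^esub> fst (enc (\<alpha>, ts)), snd (enc (\<alpha>, ts))) = enc (\<beta> \<otimes>\<^bsub>C\<^esub> \<alpha>, ts)"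
    using assms s by (auto simp: enc_def normal_def free_of_def \<theta>_mult inv_c good_def M.m_assoc inj_eq[OF inj_c])
  then show ?thesis using assms dec_enc[of "\<beta> \<otimes>\<^bsub>C\<^esub> \<alpha>" ts] by (simp add: act_def)
qed

text \<open>Multiplying by an element of \<open>S\<close> on the right cannot bring \<open>m\<close>
  into \<open>S\<close>, so a letter is really added; this detects nontriviality of reduced
  words.\<close>

lemma act_cons:
  assumes "m \<in> carrier M" "m \<notin> S" "\<alpha> \<in> carrier C" "free_of ts"
  obtains t where "good t" "snd (act m (\<alpha>, ts)) = c t # ts"
proof -
  have s: "\<theta> \<alpha> \<in> S" "\<theta> \<alpha> \<in> carrier M" using \<theta>_mem assms S_sub by auto
  have "enc (\<alpha>, ts) = (\<theta> \<alpha>, ts)" using assms by (auto simp: enc_def free_of_def)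
  moreover have "m \<otimes>\<^bsub>M\<^esub> \<theta> \<alpha> \<notin> S"
  proof
    assume "m \<otimes>\<^bsub>M\<^esub> \<theta> \<alpha> \<in> S"
    then have "(m \<otimes>\<^bsub>M\<^esub> \<theta> \<alpha>) \<otimes>\<^bsub>M\<^esub> inv\<^bsub>M\<^esub> (\<theta> \<alpha>) \<in> S"
      using s subgroup.m_closed[OF S] subgroup.m_inv_closed[OF S] by blast
    then show False using s assms by (simp add: M.m_assoc)
  qed
  moreover have "m \<otimes>\<^bsub>M\<^esub> \<theta> \<alpha> \<in> carrier M" using s assms by simp
  ultimately show thesis using that[OF rep_props(4)] by (simp add: act_def dec_def)
qed

end


section \<open>The group of words modulo the relations of the amalgamated product\<close>

locale amalgam =
  fixes H :: "'h monoid" and K :: "'k monoid" and A :: "'h set" and B :: "'k set"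
    and \<phi> :: "'h \<Rightarrow> 'k"
  assumes group_H: "group H" and group_K: "group K"
    and A: "subgroup A H" and B: "subgroup B K"
    and \<phi>: "\<phi> \<in> iso (H\<lparr>carrier := A\<rparr>) (K\<lparr>carrier := B\<rparr>)"
begin

abbreviation "L \<equiv> lists (amal_letters H K)"
abbreviation "R \<equiv> amal_rel H K A \<phi>"
abbreviation "G \<equiv> amalgamated_product H K A \<phi>"

definition cls :: "('h + 'k) list \<Rightarrow> ('h + 'k) list set" where
  "cls w = R `` {w}"

lemma A_sub: "a \<in> A \<Longrightarrow> a \<in> carrier H"
  using A by (rule subgroup.mem_carrier)

lemma B_sub: "b \<in> B \<Longrightarrow> b \<in> carrier K"
  using B by (rule subgroup.mem_carrier)

lemma \<phi>_mem: "a \<in> A \<Longrightarrow> \<phi> a \<in> B"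
  using \<phi> by (auto simp: iso_def hom_def)

lemma \<phi>_surj: "b \<in> B \<Longrightarrow> \<exists>a\<in>A. b = \<phi> a"
  using \<phi> by (auto simp: iso_def bij_betw_def)

lemma letters [simp]:
  "Inl h \<in> amal_letters H K \<longleftrightarrow> h \<in> carrier H" "Inr k \<in> amal_letters H K \<longleftrightarrow> k \<in> carrier K"
  by (auto simp: amal_letters_def)

lemma rel_words:
  assumes "(u, v) \<in> R"
  shows "u \<in> L \<and> v \<in> L"
  using assms group_H group_K
  by (induction rule: amal_rel.induct)
    (auto simp: A_sub B_sub \<phi>_mem intro: monoid.m_closed monoid.one_closed group.is_monoid)

lemma equiv_R: "equiv L R"
proof (rule equivI)
  show "R \<subseteq> L \<times> L" using rel_words by auto
  show "refl_on L R" by (auto simp: refl_on_def intro: amal_rel.refl)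
  show "sym R" by (auto simp: sym_def intro: amal_rel.sym)
  show "trans R" by (auto simp: trans_def intro: amal_rel.trans)
qed

lemma cls_eq_iff: "u \<in> L \<Longrightarrow> v \<in> L \<Longrightarrow> cls u = cls v \<longleftrightarrow> (u, v) \<in> R"
  unfolding cls_def using equiv_R by (rule eq_equiv_class_iff)

lemma cls_eqI: "(u, v) \<in> R \<Longrightarrow> cls u = cls v"
  using rel_words cls_eq_iff by blast

lemma rel_append:
  assumes "(u, u') \<in> R" "(v, v') \<in> R"
  shows "(u @ v, u' @ v') \<in> R"
proof -
  have "([] @ u @ v, [] @ u' @ v) \<in> R"
    using assms rel_words by (intro amal_rel.ctxt) auto
  moreover have "(u' @ v @ [], u' @ v' @ []) \<in> R"
    using assms rel_words by (intro amal_rel.ctxt) auto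
  ultimately show ?thesis using amal_rel.trans by fastforce
qed

lemma carrier_G: "carrier G = cls ` L"
  by (auto simp: amalgamated_product_def quotient_def cls_def)

lemma cls_closed [simp, intro]: "w \<in> L \<Longrightarrow> cls w \<in> carrier G"
  by (simp add: carrier_G)

lemma one_G: "\<one>\<^bsub>G\<^esub> = cls []"
  by (simp add: amalgamated_product_def cls_def)

lemma cls_append:
  assumes "u \<in> L" "v \<in> L"
  shows "cls (u @ v) = cls u \<otimes>\<^bsub>G\<^esub> cls v"
proof -
  have eq: "cls (u' @ v') = cls (u @ v)" if "u' \<in> cls u" "v' \<in> cls v" for u' v'
    using that rel_append[of u u' v v'] by (metis Image_singleton_iff cls_def cls_eqI)
  have mem: "u \<in> cls u" "v \<in> cls v" using assms by (auto simp: cls_def intro: amal_rel.refl)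
  have "cls u \<otimes>\<^bsub>G\<^esub> cls v = (\<Union>u'\<in>cls u. \<Union>v'\<in>cls v. cls (u' @ v'))"
    by (simp add: amalgamated_product_def cls_def)
  also have "\<dots> = (\<Union>u'\<in>cls u. \<Union>v'\<in>cls v. cls (u @ v))" using eq by simp
  also have "\<dots> = cls (u @ v)" using mem by auto
  finally show ?thesis by simp
qed

primrec letter_inv :: "'h + 'k \<Rightarrow> 'h + 'k" where
  "letter_inv (Inl h) = Inl (inv\<^bsub>H\<^esub> h)"
| "letter_inv (Inr k) = Inr (inv\<^bsub>K\<^esub> k)"

lemma letter_inv:
  assumes "s \<in> amal_letters H K"
  shows "letter_inv s \<in> amal_letters H K" "([letter_inv s, s], []) \<in> R"
proof -
  show "letter_inv s \<in> amal_letters H K"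
    using assms group_H group_K by (cases s) (auto intro: group.inv_closed)
  show "([letter_inv s, s], []) \<in> R"
  proof (cases s)
    case (Inl h)
    then have h: "h \<in> carrier H" "inv\<^bsub>H\<^esub> h \<in> carrier H" using assms group_H by (auto intro: group.inv_closed)
    have "([Inl (inv\<^bsub>H\<^esub> h), Inl h], [Inl \<one>\<^bsub>H\<^esub>]) \<in> R"
      using amal_rel.multH[OF h(2,1), of K A \<phi>] group.l_inv[OF group_H h(1)] by simp
    then show ?thesis using Inl amal_rel.trans[OF _ amal_rel.oneH] by simp
  next
    case (Inr h)
    then have h: "h \<in> carrier K" "inv\<^bsub>K\<^esub> h \<in> carrier K" using assms group_K by (auto intro: group.inv_closed)
    have "([Inr (inv\<^bsub>K\<^esub> h), Inr h], [Inr \<one>\<^bsub>K\<^esub>]) \<in> R"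
      using amal_rel.multK[OF h(2,1), of H A \<phi>] group.l_inv[OF group_K h(1)] by simp
    then show ?thesis using Inr amal_rel.trans[OF _ amal_rel.oneK] by simp
  qed
qed

lemma left_inverse_word: "w \<in> L \<Longrightarrow> \<exists>v\<in>L. (v @ w, []) \<in> R"
proof (induction w)
  case Nil
  then show ?case by (auto intro: amal_rel.refl)
next
  case (Cons s w)
  then obtain v where v: "v \<in> L" "(v @ w, []) \<in> R" by auto
  have s: "s \<in> amal_letters H K" using Cons by auto
  have "(v @ [letter_inv s, s] @ w, v @ [] @ w) \<in> R"
    using letter_inv[OF s] v Cons.prems by (intro amal_rel.ctxt) auto
  then have "((v @ [letter_inv s]) @ s # w, []) \<in> R" using amal_rel.trans v(2) by fastforce
  moreover have "v @ [letter_inv s] \<in> L" using v letter_inv[OF s] by simp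
  ultimately show ?case by blast
qed

lemma group_G: "group G"
proof (rule groupI)
  fix x y z assume "x \<in> carrier G" "y \<in> carrier G" "z \<in> carrier G"
  then obtain u v w where "x = cls u" "y = cls v" "z = cls w" "u \<in> L" "v \<in> L" "w \<in> L"
    by (auto simp: carrier_G)
  then show "x \<otimes>\<^bsub>G\<^esub> y \<otimes>\<^bsub>G\<^esub> z = x \<otimes>\<^bsub>G\<^esub> (y \<otimes>\<^bsub>G\<^esub> z)"
    by (simp add: cls_append[symmetric] del: cls_append)
next
  fix x assume "x \<in> carrier G"
  then obtain w where w: "x = cls w" "w \<in> L" by (auto simp: carrier_G)
  then show "\<one>\<^bsub>G\<^esub> \<otimes>\<^bsub>G\<^esub> x = x" using cls_append[of "[]" w] by (simp add: one_G)
  obtain v where v: "v \<in> L" "(v @ w, []) \<in> R" using left_inverse_word[OF w(2)] by blast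
  then show "\<exists>y\<in>carrier G. y \<otimes>\<^bsub>G\<^esub> x = \<one>\<^bsub>G\<^esub>"
    using cls_append[OF v(1) w(2)] cls_eqI[OF v(2)] one_G w(1) cls_closed[OF v(1)] by auto
next
  fix x y assume "x \<in> carrier G" "y \<in> carrier G"
  then obtain u v where "x = cls u" "y = cls v" "u \<in> L" "v \<in> L" by (auto simp: carrier_G)
  then show "x \<otimes>\<^bsub>G\<^esub> y \<in> carrier G" by (simp add: cls_append[symmetric] del: cls_append)
qed (simp add: one_G)

sublocale G: group G by (rule group_G)

section \<open>The action of words on normal forms\<close>

text \<open>\<open>A\<close> serves as the amalgamated subgroup for both factors, embedded in
  \<open>H\<close> by \<open>id\<close> and in \<open>K\<close> by \<open>\<phi>\<close>, so that
  both act on the same set of pairs.\<close>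

sublocale H: factor_action H "H\<lparr>carrier := A\<rparr>" A id "Inl :: 'h \<Rightarrow> 'h + 'k"
proof -
  have "group (H\<lparr>carrier := A\<rparr>)" using A group_H by (simp add: group.subgroup_imp_group)
  moreover have "id \<in> iso (H\<lparr>carrier := A\<rparr>) (H\<lparr>carrier := A\<rparr>)"
    by (auto simp: iso_def hom_def bij_betw_def)
  ultimately show "factor_action H (H\<lparr>carrier := A\<rparr>) A id (Inl :: 'h \<Rightarrow> 'h + 'k)"
    by (intro factor_action.intro factor_action_axioms.intro group_H A inj_Inl)
qed

sublocale K: factor_action K "H\<lparr>carrier := A\<rparr>" B \<phi> "Inr :: 'k \<Rightarrow> 'h + 'k"
proof -
  have "group (H\<lparr>carrier := A\<rparr>)" using A group_H by (simp add: group.subgroup_imp_group)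
  then show "factor_action K (H\<lparr>carrier := A\<rparr>) B \<phi> (Inr :: 'k \<Rightarrow> 'h + 'k)"
    by (intro factor_action.intro factor_action_axioms.intro group_K B \<phi> inj_Inr)
qed

primrec letter_act :: "'h + 'k \<Rightarrow> 'h \<times> ('h + 'k) list \<Rightarrow> 'h \<times> ('h + 'k) list" where
  "letter_act (Inl h) = H.act h"
| "letter_act (Inr k) = K.act k"

definition word_act :: "('h + 'k) list \<Rightarrow> 'h \<times> ('h + 'k) list \<Rightarrow> 'h \<times> ('h + 'k) list" where
  "word_act w \<omega> = foldr letter_act w \<omega>"

primrec normal_list :: "('h + 'k) list \<Rightarrow> bool" where
  "normal_list [] \<longleftrightarrow> True"
| "normal_list (s # ts) \<longleftrightarrow> normal_list ts \<and>
     (case s of Inl h \<Rightarrow> H.good h \<and> H.free_of ts | Inr k \<Rightarrow> K.good k \<and> K.free_of ts)"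

lemma normal_list_factor:
  assumes "normal_list ts"
  shows "H.normal ts" "K.normal ts"
  using assms
  by (cases ts; auto simp: H.normal_def K.normal_def H.free_of_def K.free_of_def split: sum.splits)+

lemma normal_list_enc:
  assumes "normal_list ts"
  shows "normal_list (snd (H.enc (\<alpha>, ts)))" "normal_list (snd (K.enc (\<alpha>, ts)))"
  using assms by (cases ts; auto simp: H.enc_def K.enc_def)+

lemma letter_act_normal:
  assumes "s \<in> amal_letters H K" "\<alpha> \<in> A" "normal_list ts"
  shows "fst (letter_act s (\<alpha>, ts)) \<in> A \<and> normal_list (snd (letter_act s (\<alpha>, ts)))"
proof (cases s)
  case (Inl h)
  then have h: "h \<in> carrier H" "\<alpha> \<in> carrier (H\<lparr>carrier := A\<rparr>)" using assms by auto
  note n = normal_list_factor[OF assms(3)] normal_list_enc[OF assms(3), of \<alpha>]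
  show ?thesis
    using H.act_form(1)[OF h n(1)] H.enc_form(2)[OF h(2) n(1)] n(3) Inl
    by (cases rule: H.act_set[OF h n(1)]) auto
next
  case (Inr k)
  then have h: "k \<in> carrier K" "\<alpha> \<in> carrier (H\<lparr>carrier := A\<rparr>)" using assms by auto
  note n = normal_list_factor[OF assms(3)] normal_list_enc[OF assms(3), of \<alpha>]
  show ?thesis
    using K.act_form(1)[OF h n(2)] K.enc_form(2)[OF h(2) n(2)] n(4) Inr
    by (cases rule: K.act_set[OF h n(2)]) auto
qed

lemma word_act_normal:
  assumes "w \<in> L" "\<alpha> \<in> A" "normal_list ts"
  shows "fst (word_act w (\<alpha>, ts)) \<in> A \<and> normal_list (snd (word_act w (\<alpha>, ts)))"
  using assms(1)
proof (induction w)
  case Nil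
  then show ?case using assms by (simp add: word_act_def)
next
  case (Cons s w)
  then show ?case
    using letter_act_normal[of s "fst (word_act w (\<alpha>, ts))" "snd (word_act w (\<alpha>, ts))"]
    by (auto simp: word_act_def)
qed

text \<open>Each defining relation is respected: products and units since the factors act, the
  amalgamation since \<open>H.act_base\<close> and \<open>K.act_base\<close> give the same
  result.\<close>

lemma word_act_rel:
  assumes "(u, v) \<in> R" "\<alpha> \<in> A" "normal_list ts"
  shows "word_act u (\<alpha>, ts) = word_act v (\<alpha>, ts)"
  using assms
proof (induction arbitrary: \<alpha> ts rule: amal_rel.induct)
  case (ctxt u v x y)
  have "word_act y (\<alpha>, ts) = (fst (word_act y (\<alpha>, ts)), snd (word_act y (\<alpha>, ts)))" by simp
  then obtain \<beta> us where "word_act y (\<alpha>, ts) = (\<beta>, us)" "\<beta> \<in> A" "normal_list us"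
    using word_act_normal[OF ctxt.hyps(3) ctxt.prems] by metis
  then show ?case using ctxt.IH[of \<beta> us] by (simp add: word_act_def)
next
  case (multH h1 h2)
  then show ?case using H.act_mult normal_list_factor by (simp add: word_act_def)
next
  case (multK k1 k2)
  then show ?case using K.act_mult normal_list_factor by (simp add: word_act_def)
next
  case oneH
  then show ?case using H.act_one normal_list_factor by (simp add: word_act_def)
next
  case oneK
  then show ?case using K.act_one normal_list_factor by (simp add: word_act_def)
next
  case (amal a)
  then show ?case
    using H.act_base[of a \<alpha> ts] K.act_base[of a \<alpha> ts] normal_list_factor by (simp add: word_act_def)
qed auto

section \<open>Reduced words\<close>

definition reduced :: "('h + 'k) list \<Rightarrow> bool" where
  "reduced w \<longleftrightarrow> w \<in> L \<and> successively (\<lambda>s t. isl s \<noteq> isl t) w \<and> set w \<inter> (Inl ` A \<union> Inr ` B) = {}"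

lemma reduced_ConsD:
  assumes "reduced (s # w)"
  shows "reduced w" "w \<noteq> [] \<Longrightarrow> isl (hd w) \<noteq> isl s" "s \<in> amal_letters H K" "s \<notin> Inl ` A \<union> Inr ` B"
  using assms by (auto simp: reduced_def successively_Cons)

text \<open>Reading from the right, each letter lies outside the amalgamated subgroup and meets a
  list that is empty or begins with a letter of the other factor. It therefore adds a letter of its
  own type.\<close>

lemma reduced_act:
  assumes "reduced w" "\<alpha> \<in> A" "w \<noteq> []"
  shows "snd (word_act w (\<alpha>, [])) \<noteq> [] \<and> isl (hd (snd (word_act w (\<alpha>, [])))) = isl (hd w)"
  using assms(1,3)
proof (induction w)
  case (Cons s w)
  note r = reduced_ConsD[OF Cons.prems(1)]
  obtain \<beta> ts where \<omega>: "word_act w (\<alpha>, []) = (\<beta>, ts)" by fastforce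
  have "w \<in> L" using r(1) by (simp add: reduced_def)
  then have \<beta>: "\<beta> \<in> A" using word_act_normal[of w \<alpha> "[]"] assms(2) \<omega> by simp
  have ts: "ts = [] \<or> isl (hd ts) \<noteq> isl s"
  proof (cases "w = []")
    case True
    then show ?thesis using \<omega> by (simp add: word_act_def)
  next
    case False
    then show ?thesis using Cons.IH[OF r(1)] r(2) \<omega> by simp
  qed
  have act: "word_act (s # w) (\<alpha>, []) = letter_act s (\<beta>, ts)" using \<omega> by (simp add: word_act_def)
  show ?case
  proof (cases s)
    case (Inl h)
    then have "h \<in> carrier H" "h \<notin> A" "H.free_of ts" using r(3,4) ts by (auto simp: H.free_of_def)
    then show ?thesis using H.act_cons[of h \<beta> ts] \<beta> act Inl by force
  next
    case (Inr k)
    then have "k \<in> carrier K" "k \<notin> B" "K.free_of ts" using r(3,4) ts by (auto simp: K.free_of_def)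
    then show ?thesis using K.act_cons[of k \<beta> ts] \<beta> act Inr by force
  qed
qed simp

text \<open>Both words are applied to the trivial normal form. The \<open>\<alpha>\<close> in front
  changes only the first component of the result and the \<open>\<beta>\<close> at the end only the
  starting pair, so the resulting lists show the types of the first letters of \<open>u\<close> and
  \<open>v\<close>.\<close>

lemma reduced_type:
  assumes "reduced u" "u \<noteq> []" "reduced v" "v \<noteq> []" "\<alpha> \<in> A" "\<beta> \<in> A"
    and eq: "cls (Inl \<alpha> # u) = cls (v @ [Inl \<beta>])"
  shows "isl (hd u) = isl (hd v)"
proof -
  have L: "u \<in> L" "v \<in> L" using assms by (auto simp: reduced_def)
  have "Inl \<alpha> # u \<in> L" "v @ [Inl \<beta>] \<in> L" using L assms by (auto simp: A_sub)
  then have "(Inl \<alpha> # u, v @ [Inl \<beta>]) \<in> R" using eq cls_eq_iff by blast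
  moreover have one: "\<one>\<^bsub>H\<^esub> \<in> A" using A by (rule subgroup.one_closed)
  ultimately have "word_act (Inl \<alpha> # u) (\<one>\<^bsub>H\<^esub>, []) = word_act (v @ [Inl \<beta>]) (\<one>\<^bsub>H\<^esub>, [])"
    using word_act_rel by simp
  moreover have "word_act (v @ [Inl \<beta>]) (\<one>\<^bsub>H\<^esub>, []) = word_act v (\<beta>, [])"
    using H.act_base[of \<beta> "\<one>\<^bsub>H\<^esub>" "[]"] assms one A_sub[of \<beta>]
    by (simp add: word_act_def H.normal_def H.free_of_def)
  moreover obtain \<gamma> ts where \<omega>: "word_act u (\<one>\<^bsub>H\<^esub>, []) = (\<gamma>, ts)" by fastforce
  moreover have "\<gamma> \<in> A" "normal_list ts" using word_act_normal[OF L(1) one, of "[]"] \<omega> by auto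
  then have "word_act (Inl \<alpha> # u) (\<one>\<^bsub>H\<^esub>, []) = (\<alpha> \<otimes>\<^bsub>H\<^esub> \<gamma>, ts)"
    using \<omega> H.act_base[of \<alpha> \<gamma> ts] assms normal_list_factor by (simp add: word_act_def)
  ultimately show ?thesis
    using reduced_act[OF assms(1) one assms(2)] reduced_act[OF assms(3,6,4)] by (metis snd_conv)
qed

section \<open>The two factors as subgroups\<close>

text \<open>The boolean index, \<open>True\<close> for \<open>H\<close> and \<open>False\<close> for
  \<open>K\<close>, allows both types of vertices to be treated at once.\<close>

definition factor :: "bool \<Rightarrow> ('h + 'k) list set set" where
  "factor q = (\<lambda>s. cls [s]) ` {s \<in> amal_letters H K. isl s = q}"

lemma cls_Cons: "s \<in> amal_letters H K \<Longrightarrow> w \<in> L \<Longrightarrow> cls (s # w) = cls [s] \<otimes>\<^bsub>G\<^esub> cls w"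
  using cls_append[of "[s]" w] by simp

lemma cls_Inl_mult:
  "h \<in> carrier H \<Longrightarrow> h' \<in> carrier H \<Longrightarrow> cls [Inl h] \<otimes>\<^bsub>G\<^esub> cls [Inl h'] = cls [Inl (h \<otimes>\<^bsub>H\<^esub> h')]"
  using cls_append[of "[Inl h]" "[Inl h']"] cls_eqI[OF amal_rel.multH] by simp

lemma cls_Inr_mult:
  "k \<in> carrier K \<Longrightarrow> k' \<in> carrier K \<Longrightarrow> cls [Inr k] \<otimes>\<^bsub>G\<^esub> cls [Inr k'] = cls [Inr (k \<otimes>\<^bsub>K\<^esub> k')]"
  using cls_append[of "[Inr k]" "[Inr k']"] cls_eqI[OF amal_rel.multK] by simp

lemma cls_amal: "a \<in> A \<Longrightarrow> cls [Inl a] = cls [Inr (\<phi> a)]"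
  by (rule cls_eqI[OF amal_rel.amal])

lemma cls_letter_inv:
  assumes "s \<in> amal_letters H K"
  shows "inv\<^bsub>G\<^esub> cls [s] = cls [letter_inv s]"
proof (rule G.inv_equality)
  show "cls [letter_inv s] \<otimes>\<^bsub>G\<^esub> cls [s] = \<one>\<^bsub>G\<^esub>"
    using cls_append[of "[letter_inv s]" "[s]"] letter_inv[OF assms] cls_eqI assms by (simp add: one_G)
qed (use assms letter_inv[OF assms] in auto)

lemma factor_cases:
  assumes "x \<in> factor q"
  obtains h where "q" "h \<in> carrier H" "x = cls [Inl h]" | k where "\<not> q" "k \<in> carrier K" "x = cls [Inr k]"
proof -
  from assms obtain s where "s \<in> amal_letters H K" "isl s = q" "x = cls [s]" by (auto simp: factor_def)
  then show thesis using that by (cases s) auto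
qed

lemma factorI: "s \<in> amal_letters H K \<Longrightarrow> cls [s] \<in> factor (isl s)"
  by (auto simp: factor_def)

lemma subgroup_factor: "subgroup (factor q) G"
proof (rule G.subgroupI)
  show "factor q \<subseteq> carrier G" by (auto simp: factor_def)
  have "Inl \<one>\<^bsub>H\<^esub> \<in> amal_letters H K" "Inr \<one>\<^bsub>K\<^esub> \<in> amal_letters H K" by auto
  then show "factor q \<noteq> {}" using factorI[of "Inl \<one>\<^bsub>H\<^esub>"] factorI[of "Inr \<one>\<^bsub>K\<^esub>"] by (cases q) auto
  show "inv\<^bsub>G\<^esub> x \<in> factor q" if "x \<in> factor q" for x
  proof -
    from that obtain s where s: "s \<in> amal_letters H K" "isl s = q" "x = cls [s]" by (auto simp: factor_def)
    have "isl (letter_inv s) = isl s" by (cases s) auto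
    then show ?thesis using cls_letter_inv[OF s(1)] factorI[OF letter_inv(1)[OF s(1)]] s by simp
  qed
  show "x \<otimes>\<^bsub>G\<^esub> y \<in> factor q" if xy: "x \<in> factor q" "y \<in> factor q" for x y
  proof (cases q)
    case True
    then obtain h h' where "h \<in> carrier H" "x = cls [Inl h]" "h' \<in> carrier H" "y = cls [Inl h']"
      using xy by (metis factor_cases)
    then show ?thesis using factorI[of "Inl (h \<otimes>\<^bsub>H\<^esub> h')"] True by (simp add: cls_Inl_mult)
  next
    case False
    then obtain h h' where "h \<in> carrier K" "x = cls [Inr h]" "h' \<in> carrier K" "y = cls [Inr h']"
      using xy by (metis factor_cases)
    then show ?thesis using factorI[of "Inr (h \<otimes>\<^bsub>K\<^esub> h')"] False by (simp add: cls_Inr_mult)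
  qed
qed

lemma amal_in_factor:
  assumes "a \<in> A"
  shows "cls [Inl a] \<in> factor q"
  using factorI[of "Inl a"] factorI[of "Inr (\<phi> a)"] assms A_sub[OF assms] B_sub[OF \<phi>_mem[OF assms]]
    cls_amal[OF assms] by (cases q) auto

end

subsection \<open>A derivation on the amalgamated product\<close>

text \<open>The group acts on its Bass-Serre tree, whose edges are the left cosets of the amalgamated
  subgroup. For a quotient \<open>V\<close> the edges of the quotient graph are the left cosets of the image of
  that subgroup, and \<open>D w\<close> is the 1-chain of the path from the base vertex (the one fixed by \<open>H\<close>) to its
  translate by \<open>w\<close>.\<close>

locale amalgam_quotient = amalgam H K A B \<phi>
  for H :: "'h monoid" and K :: "'k monoid" and A :: "'h set" and B :: "'k set"
    and \<phi> :: "'h \<Rightarrow> 'k" +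
  fixes V :: "'v monoid" and \<pi> :: "('h + 'k) list set \<Rightarrow> 'v"
  assumes group_V: "group V" and finite_V: "finite (carrier V)" and \<pi>: "\<pi> \<in> hom G V"
begin

sublocale V: group V by (rule group_V)

sublocale \<pi>: group_hom G V \<pi>
  using \<pi> by unfold_locales

definition val :: "('h + 'k) list \<Rightarrow> 'v" where
  "val w = \<pi> (cls w)"

definition A' :: "'v set" where
  "A' = (\<lambda>a. val [Inl a]) ` A"

definition edges :: "'v set set" where
  "edges = (\<lambda>x. x <#\<^bsub>V\<^esub> A') ` carrier V"

definition base :: "'v set \<Rightarrow> int" where
  "base e = of_bool (e = A')"

text \<open>The path from the base vertex to the vertex fixed by the factor of the letter: empty for
  \<open>H\<close>, the base edge for \<open>K\<close>.\<close>

primrec anchor :: "'h + 'k \<Rightarrow> 'v set \<Rightarrow> int" where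
  "anchor (Inl h) = (\<lambda>e. 0)"
| "anchor (Inr k) = base"

text \<open>The path for \<open>s # w\<close> goes to the vertex fixed by \<open>s\<close>, returns
  along the translate by \<open>s\<close> of the same way, and continues with the translated path of
  \<open>w\<close>. Translating a chain means evaluating it at the inverse translate of the
  edge.\<close>

primrec D :: "('h + 'k) list \<Rightarrow> 'v set \<Rightarrow> int" where
  "D [] e = 0"
| "D (s # w) e = anchor s e - anchor s (inv\<^bsub>V\<^esub> val [s] <#\<^bsub>V\<^esub> e) + D w (inv\<^bsub>V\<^esub> val [s] <#\<^bsub>V\<^esub> e)"

lemma val_closed [simp]: "w \<in> L \<Longrightarrow> val w \<in> carrier V"
  by (simp add: val_def)

lemma val_append: "u \<in> L \<Longrightarrow> v \<in> L \<Longrightarrow> val (u @ v) = val u \<otimes>\<^bsub>V\<^esub> val v"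
  by (simp add: val_def cls_append)

lemma val_Cons: "s \<in> amal_letters H K \<Longrightarrow> w \<in> L \<Longrightarrow> val (s # w) = val [s] \<otimes>\<^bsub>V\<^esub> val w"
  using val_append[of "[s]" w] by simp

lemma val_Nil [simp]: "val [] = \<one>\<^bsub>V\<^esub>"
  using \<pi>.hom_one by (simp add: val_def one_G)

lemma val_rel: "(u, v) \<in> R \<Longrightarrow> val u = val v"
  by (simp add: val_def cls_eqI)

lemma subgroup_A': "subgroup A' V"
proof -
  have "subgroup (\<pi> ` ((\<lambda>a. cls [Inl a]) ` A)) V"
  proof (rule \<pi>.subgroup_img_is_subgroup, rule G.subgroupI)
    show "(\<lambda>a. cls [Inl a]) ` A \<subseteq> carrier G" by (auto simp: A_sub)
    show "(\<lambda>a. cls [Inl a]) ` A \<noteq> {}" using subgroup.one_closed[OF A] by blast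
    show "inv\<^bsub>G\<^esub> x \<in> (\<lambda>a. cls [Inl a]) ` A" if "x \<in> (\<lambda>a. cls [Inl a]) ` A" for x
      using that subgroup.m_inv_closed[OF A] by (auto simp: cls_letter_inv A_sub)
    show "x \<otimes>\<^bsub>G\<^esub> y \<in> (\<lambda>a. cls [Inl a]) ` A"
      if "x \<in> (\<lambda>a. cls [Inl a]) ` A" "y \<in> (\<lambda>a. cls [Inl a]) ` A" for x y
      using that subgroup.m_closed[OF A] by (auto simp: cls_Inl_mult A_sub)
  qed
  then show ?thesis by (simp add: A'_def val_def image_image)
qed

lemma A'_sub: "A' \<subseteq> carrier V"
  using subgroup_A' by (rule subgroup.subset)

sublocale set_action V edges "\<lambda>x e. x <#\<^bsub>V\<^esub> e"
  by unfold_locales (auto simp: edges_def V.m_assoc V.lcos_m_assoc V.lcos_mult_one A'_sub V.l_coset_subset_G)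

lemma A'_edge: "A' \<in> edges"
  unfolding edges_def using V.lcos_mult_one[OF A'_sub] by (metis V.one_closed imageI)

lemma coset_edge: "x \<in> carrier V \<Longrightarrow> x <#\<^bsub>V\<^esub> A' \<in> edges"
  by (simp add: edges_def)

lemma finite_edges: "finite edges"
  by (simp add: edges_def finite_V)

lemma coset_eq_iff:
  assumes "x \<in> carrier V" "y \<in> carrier V"
  shows "x <#\<^bsub>V\<^esub> A' = y <#\<^bsub>V\<^esub> A' \<longleftrightarrow> inv\<^bsub>V\<^esub> x \<otimes>\<^bsub>V\<^esub> y \<in> A'"
proof
  assume "x <#\<^bsub>V\<^esub> A' = y <#\<^bsub>V\<^esub> A'"
  then have "y \<in> x <#\<^bsub>V\<^esub> A'" using V.lcos_self[OF assms(2) subgroup_A'] by simp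
  then show "inv\<^bsub>V\<^esub> x \<otimes>\<^bsub>V\<^esub> y \<in> A'" using subgroup.lcos_module_imp[OF subgroup_A' group_V assms(1)] by simp
next
  assume a: "inv\<^bsub>V\<^esub> x \<otimes>\<^bsub>V\<^esub> y \<in> A'"
  have "y = x \<otimes>\<^bsub>V\<^esub> (inv\<^bsub>V\<^esub> x \<otimes>\<^bsub>V\<^esub> y)" using assms by (simp add: V.m_assoc[symmetric])
  then have "y \<in> x <#\<^bsub>V\<^esub> A'" using a unfolding l_coset_def by blast
  then show "x <#\<^bsub>V\<^esub> A' = y <#\<^bsub>V\<^esub> A'" using V.l_repr_independence[OF _ assms(1) subgroup_A'] by simp
qed

lemma base_translate:
  assumes "x \<in> carrier V" "e \<in> edges"
  shows "base (inv\<^bsub>V\<^esub> x <#\<^bsub>V\<^esub> e) = of_bool (e = x <#\<^bsub>V\<^esub> A')"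
  using act_inv_act[OF assms] act_inv_act[OF assms(1) A'_edge] by (auto simp: base_def)

lemma inv_mult_act:
  assumes "x \<in> carrier V" "y \<in> carrier V" "e \<in> edges"
  shows "inv\<^bsub>V\<^esub> y <#\<^bsub>V\<^esub> (inv\<^bsub>V\<^esub> x <#\<^bsub>V\<^esub> e) = inv\<^bsub>V\<^esub> (x \<otimes>\<^bsub>V\<^esub> y) <#\<^bsub>V\<^esub> e"
  using assms act_mult[of "inv\<^bsub>V\<^esub> y" "inv\<^bsub>V\<^esub> x" e] by (simp add: V.inv_mult_group)

lemma D_append:
  assumes "u \<in> L" "v \<in> L" "e \<in> edges"
  shows "D (u @ v) e = D u e + D v (inv\<^bsub>V\<^esub> val u <#\<^bsub>V\<^esub> e)"
  using assms(1,3)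
proof (induction u arbitrary: e)
  case Nil
  then show ?case using act_one[of e] by simp
next
  case (Cons s u)
  have s: "s \<in> amal_letters H K" "u \<in> L" using Cons.hyps by simp_all
  have "inv\<^bsub>V\<^esub> val [s] <#\<^bsub>V\<^esub> e \<in> edges" using s Cons.prems act_closed by simp
  then show ?case using Cons.IH[of "inv\<^bsub>V\<^esub> val [s] <#\<^bsub>V\<^esub> e"] s Cons.prems
    inv_mult_act[of "val [s]" "val u" e] val_Cons[OF s] by simp
qed

text \<open>For products in a factor the anchor terms telescope. For the amalgamation both sides
  vanish: \<open>Inl a\<close> has no anchor, and the base edge is fixed by
  \<open>A'\<close>.\<close>

lemma D_rel:
  assumes "(u, v) \<in> R" "e \<in> edges"
  shows "D u e = D v e"
  using assms
proof (induction arbitrary: e rule: amal_rel.induct)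
  case (ctxt u v x y)
  have w: "u \<in> L" "v \<in> L" using rel_words[OF ctxt.hyps(1)] by auto
  have e: "inv\<^bsub>V\<^esub> val x <#\<^bsub>V\<^esub> e \<in> edges" using ctxt act_closed by simp
  show ?case using ctxt.IH[OF e] w e ctxt.prems ctxt.hyps(2,3) val_rel[OF ctxt.hyps(1)]
    by (simp add: D_append)
next
  case (multK k1 k2)
  then have "val [Inr (k1 \<otimes>\<^bsub>K\<^esub> k2)] = val [Inr k1] \<otimes>\<^bsub>V\<^esub> val [Inr k2]"
    using val_rel[OF amal_rel.multK[of k1 K k2 H A \<phi>]] val_append[of "[Inr k1]" "[Inr k2]"] by simp
  then show ?case using multK inv_mult_act[of "val [Inr k1]" "val [Inr k2]" e] by simp
next
  case oneK
  then show ?case using val_rel[OF amal_rel.oneK[of K H A \<phi>]] act_one[of e] by simp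
next
  case (amal a)
  have a: "\<phi> a \<in> carrier K" using amal B_sub \<phi>_mem by blast
  have "val [Inr (\<phi> a)] \<in> A'" using amal val_rel[OF amal_rel.amal[OF amal(1)], symmetric] by (auto simp: A'_def)
  then have "val [Inr (\<phi> a)] <#\<^bsub>V\<^esub> A' = A'"
    using coset_eq_iff[of "\<one>\<^bsub>V\<^esub>" "val [Inr (\<phi> a)]"] a V.lcos_mult_one[OF A'_sub] by simp
  then show ?case using base_translate[of "val [Inr (\<phi> a)]" e] a amal by (simp add: base_def)
qed (auto)

definition deriv :: "('h + 'k) list set \<Rightarrow> 'v set \<Rightarrow> int" where
  "deriv g = D (SOME w. w \<in> L \<and> cls w = g)"

lemma deriv_cls:
  assumes "w \<in> L" "e \<in> edges"
  shows "deriv (cls w) e = D w e"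
proof -
  let ?w = "SOME u. u \<in> L \<and> cls u = cls w"
  have "?w \<in> L \<and> cls ?w = cls w" by (rule someI[of _ w]) (use assms in simp)
  then show ?thesis unfolding deriv_def using D_rel assms cls_eq_iff by blast
qed

text \<open>\<open>deriv\<close> is a crossed homomorphism, so it gives a map to a wreath product.
  The two assumptions on \<open>w\<close> in \<open>sep\<close> are the two components of the
  equation that makes \<open>w\<close> a conjugator there.\<close>

lemma p_separated_by_deriv:
  assumes p: "Factorial_Ring.prime (p :: nat)" and V: "finite_p_group p V"
    and ab: "wa \<in> L" "wb \<in> L"
    and sep: "\<And>w. w \<in> L \<Longrightarrow> val w \<otimes>\<^bsub>V\<^esub> val wb = val wa \<otimes>\<^bsub>V\<^esub> val w \<Longrightarrow>
       (\<And>e. e \<in> edges \<Longrightarrow> D (w @ wb) e mod int (p ^ k) = D (wa @ w) e mod int (p ^ k)) \<Longrightarrow> False"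
  shows "p_separated p G (cls wa) (cls wb)"
proof (rule p_separatedI[OF group_G p, of _ "\<lambda>g. (\<lambda>e\<in>edges. deriv g e mod int (p ^ k), \<pi> g)"])
  show "finite_p_group p (wreath (int (p ^ k)) edges (\<lambda>x e. x <#\<^bsub>V\<^esub> e) V)"
    using V finite_edges p by (intro wreath_finite_p_group) (auto simp: prime_gt_0_nat)
  show "(\<lambda>g. (\<lambda>e\<in>edges. deriv g e mod int (p ^ k), \<pi> g)) \<in> hom G (wreath (int (p ^ k)) edges (\<lambda>x e. x <#\<^bsub>V\<^esub> e) V)"
  proof (rule wreath_homI)
    show "0 < int (p ^ k)" using p by (simp add: prime_gt_0_nat)
    show "\<pi> \<in> hom G V" by (rule \<pi>)
    fix g h e assume g: "g \<in> carrier G" "h \<in> carrier G" and e: "e \<in> edges"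
    then obtain u v where uv: "g = cls u" "h = cls v" "u \<in> L" "v \<in> L" by (auto simp: carrier_G)
    then have "inv\<^bsub>V\<^esub> \<pi> g <#\<^bsub>V\<^esub> e \<in> edges" using g e act_closed by simp
    then show "deriv (g \<otimes>\<^bsub>G\<^esub> h) e = deriv g e + deriv h (inv\<^bsub>V\<^esub> \<pi> g <#\<^bsub>V\<^esub> e)"
      using uv e deriv_cls[of "u @ v" e] by (simp add: cls_append deriv_cls D_append val_def)
  qed
  fix g assume "g \<in> carrier G"
  then obtain w where w: "g = cls w" "w \<in> L" by (auto simp: carrier_G)
  show "(\<lambda>e\<in>edges. deriv (g \<otimes>\<^bsub>G\<^esub> cls wb) e mod int (p ^ k), \<pi> (g \<otimes>\<^bsub>G\<^esub> cls wb)) \<noteq>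
    (\<lambda>e\<in>edges. deriv (cls wa \<otimes>\<^bsub>G\<^esub> g) e mod int (p ^ k), \<pi> (cls wa \<otimes>\<^bsub>G\<^esub> g))" (is "?x \<noteq> ?y")
  proof
    assume eq: "?x = ?y"
    show False
    proof (rule sep[OF w(2)])
      show "val w \<otimes>\<^bsub>V\<^esub> val wb = val wa \<otimes>\<^bsub>V\<^esub> val w"
        using eq w ab by (simp add: val_def)
      show "D (w @ wb) e mod int (p ^ k) = D (wa @ w) e mod int (p ^ k)" if e: "e \<in> edges" for e
        using fun_cong[OF conjunct1[OF eq[unfolded prod.inject]], of e] e w ab
          deriv_cls[of "w @ wb" e] deriv_cls[of "wa @ w" e] by (simp add: cls_append)
    qed
  qed
qed (use ab in auto)

end

context amalgam_quotient
begin

subsection \<open>Elements of the factors\<close>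

text \<open>\<open>fixed a True\<close> and \<open>fixed a False\<close> describe the images in the quotient graph of the vertices of the
  tree that \<open>a\<close> fixes, of either type.\<close>

definition fixed :: "('h + 'k) list set \<Rightarrow> bool \<Rightarrow> 'v set" where
  "fixed a q = \<pi> ` {g \<in> carrier G. inv\<^bsub>G\<^esub> g \<otimes>\<^bsub>G\<^esub> a \<otimes>\<^bsub>G\<^esub> g \<in> factor q}"

text \<open>Replacing \<open>g\<close> by its product with \<open>y\<close> keeps the coset of the
  factor, hence the vertex of the tree.\<close>

lemma fixed_mult_factor:
  assumes a: "a \<in> carrier G" and y: "y \<in> factor q" and x: "x \<in> fixed a q"
  shows "x \<otimes>\<^bsub>V\<^esub> \<pi> y \<in> fixed a q"
proof -
  from x obtain g where g: "g \<in> carrier G" "x = \<pi> g" "inv\<^bsub>G\<^esub> g \<otimes>\<^bsub>G\<^esub> a \<otimes>\<^bsub>G\<^esub> g \<in> factor q"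
    by (auto simp: fixed_def)
  have yG: "y \<in> carrier G" using y subgroup.mem_carrier[OF subgroup_factor] by blast
  have "inv\<^bsub>G\<^esub> (g \<otimes>\<^bsub>G\<^esub> y) \<otimes>\<^bsub>G\<^esub> a \<otimes>\<^bsub>G\<^esub> (g \<otimes>\<^bsub>G\<^esub> y) = inv\<^bsub>G\<^esub> y \<otimes>\<^bsub>G\<^esub> (inv\<^bsub>G\<^esub> g \<otimes>\<^bsub>G\<^esub> a \<otimes>\<^bsub>G\<^esub> g) \<otimes>\<^bsub>G\<^esub> y"
    using g yG a by (simp add: G.inv_mult_group G.m_assoc)
  also have "\<dots> \<in> factor q"
    by (rule subgroup.m_closed[OF subgroup_factor subgroup.m_closed[OF subgroup_factor subgroup.m_inv_closed[OF subgroup_factor y] g(3)] y])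
  finally show ?thesis using g yG unfolding fixed_def by (intro image_eqI[of _ _ "g \<otimes>\<^bsub>G\<^esub> y"]) auto
qed

lemma fixed_mult_factor_iff:
  assumes a: "a \<in> carrier G" and y: "y \<in> factor q" and x: "x \<in> carrier V"
  shows "x \<otimes>\<^bsub>V\<^esub> \<pi> y \<in> fixed a q \<longleftrightarrow> x \<in> fixed a q"
proof
  have yG: "y \<in> carrier G" using y subgroup.mem_carrier[OF subgroup_factor] by blast
  assume "x \<otimes>\<^bsub>V\<^esub> \<pi> y \<in> fixed a q"
  from fixed_mult_factor[OF a subgroup.m_inv_closed[OF subgroup_factor y] this]
  show "x \<in> fixed a q" using x yG by (simp add: V.m_assoc)
qed (rule fixed_mult_factor[OF a y])

lemma coset_subset_fixed:
  assumes "a \<in> carrier G" "x \<in> carrier V"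
  shows "x <#\<^bsub>V\<^esub> A' \<subseteq> fixed a q \<longleftrightarrow> x \<in> fixed a q"
proof
  show "x \<in> fixed a q" if "x <#\<^bsub>V\<^esub> A' \<subseteq> fixed a q"
    using that V.lcos_self[OF assms(2) subgroup_A'] by blast
  show "x <#\<^bsub>V\<^esub> A' \<subseteq> fixed a q" if "x \<in> fixed a q"
    using fixed_mult_factor[OF assms(1) amal_in_factor that]
    by (auto simp: l_coset_def A'_def val_def)
qed

text \<open>Since \<open>a\<close> commutes with itself, moving \<open>g\<close> by \<open>a\<close>
  or its inverse on the left does not change the conjugate of \<open>a\<close> by
  \<open>g\<close>.\<close>

lemma fixed_left_mult:
  assumes a: "a \<in> carrier G" and x: "x \<in> fixed a q"
  shows "\<pi> a \<otimes>\<^bsub>V\<^esub> x \<in> fixed a q" "inv\<^bsub>V\<^esub> \<pi> a \<otimes>\<^bsub>V\<^esub> x \<in> fixed a q"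
proof -
  from x obtain g where g: "g \<in> carrier G" "x = \<pi> g" "inv\<^bsub>G\<^esub> g \<otimes>\<^bsub>G\<^esub> a \<otimes>\<^bsub>G\<^esub> g \<in> factor q"
    by (auto simp: fixed_def)
  have cancel: "a \<otimes>\<^bsub>G\<^esub> (inv\<^bsub>G\<^esub> a \<otimes>\<^bsub>G\<^esub> g) = g" "inv\<^bsub>G\<^esub> a \<otimes>\<^bsub>G\<^esub> (a \<otimes>\<^bsub>G\<^esub> (a \<otimes>\<^bsub>G\<^esub> g)) = a \<otimes>\<^bsub>G\<^esub> g"
    using a g(1) by (simp_all add: G.m_assoc[symmetric])
  have 1: "inv\<^bsub>G\<^esub> (a \<otimes>\<^bsub>G\<^esub> g) \<otimes>\<^bsub>G\<^esub> a \<otimes>\<^bsub>G\<^esub> (a \<otimes>\<^bsub>G\<^esub> g) \<in> factor q"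
    using a g cancel by (simp add: G.inv_mult_group G.m_assoc)
  have 2: "inv\<^bsub>G\<^esub> (inv\<^bsub>G\<^esub> a \<otimes>\<^bsub>G\<^esub> g) \<otimes>\<^bsub>G\<^esub> a \<otimes>\<^bsub>G\<^esub> (inv\<^bsub>G\<^esub> a \<otimes>\<^bsub>G\<^esub> g) \<in> factor q"
    using a g cancel by (simp add: G.inv_mult_group G.m_assoc)
  show "\<pi> a \<otimes>\<^bsub>V\<^esub> x \<in> fixed a q" unfolding fixed_def
    by (rule image_eqI[of _ _ "a \<otimes>\<^bsub>G\<^esub> g"]) (use 1 a g in auto)
  show "inv\<^bsub>V\<^esub> \<pi> a \<otimes>\<^bsub>V\<^esub> x \<in> fixed a q" unfolding fixed_def
    by (rule image_eqI[of _ _ "inv\<^bsub>G\<^esub> a \<otimes>\<^bsub>G\<^esub> g"]) (use 2 a g in auto)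
qed

lemma fixed_left_mult_iff:
  assumes a: "a \<in> carrier G" and x: "x \<in> carrier V"
  shows "\<pi> a \<otimes>\<^bsub>V\<^esub> x \<in> fixed a q \<longleftrightarrow> x \<in> fixed a q"
  using fixed_left_mult(1)[OF a, of x q] fixed_left_mult(2)[OF a, of "\<pi> a \<otimes>\<^bsub>V\<^esub> x" q] a x
  by (auto simp: V.m_assoc[symmetric])

text \<open>Pairing a 1-chain with \<open>flux a\<close> sums its boundary over the vertices in \<open>fixed a\<close>.\<close>

definition flux :: "('h + 'k) list set \<Rightarrow> 'v set \<Rightarrow> int" where
  "flux a e = of_bool (e \<subseteq> fixed a False) - of_bool (e \<subseteq> fixed a True)"

lemma flux_coset:
  assumes "a \<in> carrier G" "x \<in> carrier V"
  shows "flux a (x <#\<^bsub>V\<^esub> A') = of_bool (x \<in> fixed a False) - of_bool (x \<in> fixed a True)"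
  using coset_subset_fixed[OF assms] by (simp add: flux_def)

lemma flux_act:
  assumes a: "a \<in> carrier G" and e: "e \<in> edges"
  shows "flux a (\<pi> a <#\<^bsub>V\<^esub> e) = flux a e"
proof -
  from e obtain x where x: "x \<in> carrier V" "e = x <#\<^bsub>V\<^esub> A'" by (auto simp: edges_def)
  then have "\<pi> a <#\<^bsub>V\<^esub> e = (\<pi> a \<otimes>\<^bsub>V\<^esub> x) <#\<^bsub>V\<^esub> A'" using a A'_sub by (simp add: V.lcos_m_assoc)
  then show ?thesis using flux_coset[OF a] x a fixed_left_mult_iff[OF a x(1)] by simp
qed

text \<open>If one end of the edge is counted, a conjugate of \<open>a\<close> lies in a factor and
  has its image in \<open>A'\<close>. Injectivity puts it into the amalgamated subgroup, hence into
  both factors, so the other end is counted as well and the two terms cancel.\<close>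

lemma flux_fixed_edge:
  assumes a: "a \<in> carrier G" and e: "e \<in> edges" "\<pi> a <#\<^bsub>V\<^esub> e = e"
    and inj: "\<And>q. inj_on \<pi> (factor q)"
  shows "flux a e = 0"
proof -
  from e obtain x where x: "x \<in> carrier V" "e = x <#\<^bsub>V\<^esub> A'" by (auto simp: edges_def)
  have "x <#\<^bsub>V\<^esub> A' = (\<pi> a \<otimes>\<^bsub>V\<^esub> x) <#\<^bsub>V\<^esub> A'" using x a A'_sub e by (simp add: V.lcos_m_assoc)
  then have mem: "inv\<^bsub>V\<^esub> x \<otimes>\<^bsub>V\<^esub> (\<pi> a \<otimes>\<^bsub>V\<^esub> x) \<in> A'" using coset_eq_iff x(1) a by simp
  have "x \<in> fixed a q'" if xq: "x \<in> fixed a q" for q q'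
  proof -
    from xq obtain g where g: "g \<in> carrier G" "x = \<pi> g" "inv\<^bsub>G\<^esub> g \<otimes>\<^bsub>G\<^esub> a \<otimes>\<^bsub>G\<^esub> g \<in> factor q"
      by (auto simp: fixed_def)
    from mem obtain \<alpha> where \<alpha>: "\<alpha> \<in> A" "inv\<^bsub>V\<^esub> x \<otimes>\<^bsub>V\<^esub> (\<pi> a \<otimes>\<^bsub>V\<^esub> x) = \<pi> (cls [Inl \<alpha>])"
      by (auto simp: A'_def val_def)
    then have "\<pi> (inv\<^bsub>G\<^esub> g \<otimes>\<^bsub>G\<^esub> a \<otimes>\<^bsub>G\<^esub> g) = \<pi> (cls [Inl \<alpha>])"
      using g a by (simp add: V.m_assoc)
    then have "inv\<^bsub>G\<^esub> g \<otimes>\<^bsub>G\<^esub> a \<otimes>\<^bsub>G\<^esub> g = cls [Inl \<alpha>]"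
      using inj_onD[OF inj _ g(3) amal_in_factor[OF \<alpha>(1)]] by simp
    then have "inv\<^bsub>G\<^esub> g \<otimes>\<^bsub>G\<^esub> a \<otimes>\<^bsub>G\<^esub> g \<in> factor q'" using amal_in_factor[OF \<alpha>(1)] by simp
    then show ?thesis using g by (auto simp: fixed_def)
  qed
  then have "x \<in> fixed a True \<longleftrightarrow> x \<in> fixed a False" by blast
  then show ?thesis using flux_coset[OF a x(1)] x(2) by simp
qed

lemma sum_flux_base:
  assumes a: "a \<in> carrier G" and x: "x \<in> carrier V"
  shows "(\<Sum>e\<in>edges. base (inv\<^bsub>V\<^esub> x <#\<^bsub>V\<^esub> e) * flux a e) =
    of_bool (x \<in> fixed a False) - of_bool (x \<in> fixed a True)"
proof -
  have "(\<Sum>e\<in>edges. base (inv\<^bsub>V\<^esub> x <#\<^bsub>V\<^esub> e) * flux a e) =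
      (\<Sum>e\<in>edges. if e = x <#\<^bsub>V\<^esub> A' then flux a e else 0)"
    by (intro sum.cong) (auto simp: base_translate[OF x])
  then show ?thesis using coset_edge[OF x] flux_coset[OF a x] by (simp add: finite_edges sum.delta)
qed

lemma sum_flux_anchor:
  assumes a: "a \<in> carrier G" and x: "x \<in> carrier V"
  shows "(\<Sum>e\<in>edges. anchor s (inv\<^bsub>V\<^esub> x <#\<^bsub>V\<^esub> e) * flux a e) =
    of_bool (x \<in> fixed a (isl s)) - of_bool (x \<in> fixed a True)"
  using sum_flux_base[OF a x] by (cases s) auto

text \<open>The boundary of the path is its end minus its start, both of type \<open>H\<close>; the
  pairing evaluates this boundary on the vertices in \<open>fixed a True\<close>.\<close>

lemma sum_flux_D:
  assumes a: "a \<in> carrier G" and w: "w \<in> L"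
  shows "(\<Sum>e\<in>edges. D w e * flux a e) =
    of_bool (val w \<in> fixed a True) - of_bool (\<one>\<^bsub>V\<^esub> \<in> fixed a True)"
  using w
proof (induction w rule: rev_induct)
  case (snoc s w)
  then have s: "s \<in> amal_letters H K" "w \<in> L" by auto
  have vs: "val w \<in> carrier V" "val [s] \<in> carrier V" "val (w @ [s]) = val w \<otimes>\<^bsub>V\<^esub> val [s]"
    using s val_append[of w "[s]"] by auto
  have D: "D (w @ [s]) e = D w e + (anchor s (inv\<^bsub>V\<^esub> val w <#\<^bsub>V\<^esub> e) - anchor s (inv\<^bsub>V\<^esub> val (w @ [s]) <#\<^bsub>V\<^esub> e))"
    if "e \<in> edges" for e
    using D_append[of w "[s]" e] s that vs by (simp add: inv_mult_act)
  have "(\<Sum>e\<in>edges. D (w @ [s]) e * flux a e) = (\<Sum>e\<in>edges. D w e * flux a e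
    + anchor s (inv\<^bsub>V\<^esub> val w <#\<^bsub>V\<^esub> e) * flux a e - anchor s (inv\<^bsub>V\<^esub> val (w @ [s]) <#\<^bsub>V\<^esub> e) * flux a e)"
    by (rule sum.cong) (simp_all add: D algebra_simps)
  then have "(\<Sum>e\<in>edges. D (w @ [s]) e * flux a e) = (\<Sum>e\<in>edges. D w e * flux a e)
    + (\<Sum>e\<in>edges. anchor s (inv\<^bsub>V\<^esub> val w <#\<^bsub>V\<^esub> e) * flux a e)
    - (\<Sum>e\<in>edges. anchor s (inv\<^bsub>V\<^esub> val (w @ [s]) <#\<^bsub>V\<^esub> e) * flux a e)"
    by (simp only: sum.distrib sum_subtractf)
  \<comment> \<open>Multiplying by \<open>s\<close> keeps the vertex of the type of
    \<open>s\<close>, so the outward and the return way contribute equally there.\<close>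
  moreover have "val (w @ [s]) \<in> fixed a (isl s) \<longleftrightarrow> val w \<in> fixed a (isl s)"
    using fixed_mult_factor_iff[OF a factorI[OF s(1)] vs(1)] vs(3) by (simp add: val_def)
  ultimately show ?case
    using snoc.IH[OF s(2)] sum_flux_anchor[OF a, of "val w" s] sum_flux_anchor[OF a, of "val (w @ [s])" s] vs
    by simp
qed simp

lemma p_separated_factor:
  assumes p: "Factorial_Ring.prime (p :: nat)" and V: "finite_p_group p V"
    and inj: "\<And>q. inj_on \<pi> (factor q)"
    and st: "s \<in> amal_letters H K" "t \<in> amal_letters H K"
    and nc: "\<not> conjugate_in G (cls [s]) (cls [t])"
  shows "p_separated p G (cls [s]) (cls [t])"
proof (rule p_separated_by_deriv[OF p V, where k = 1])
  fix w assume w: "w \<in> L" and val: "val w \<otimes>\<^bsub>V\<^esub> val [t] = val [s] \<otimes>\<^bsub>V\<^esub> val w"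
    and D: "\<And>e. e \<in> edges \<Longrightarrow> D (w @ [t]) e mod int (p ^ 1) = D ([s] @ w) e mod int (p ^ 1)"
  let ?a = "cls [s]"
  have a: "?a \<in> carrier G" using st by simp
  have vs: "val w \<in> carrier V" "val [s] \<in> carrier V" "val [t] \<in> carrier V" "\<pi> ?a = val [s]"
    using w st by (auto simp: val_def)
  \<comment> \<open>\<open>D w\<close> extended at both ends: a path from the vertex fixed by
    \<open>s\<close> to the translate by \<open>w\<close> of the vertex fixed by \<open>t\<close>.
    As \<open>w\<close> conjugates the images, it is invariant under \<open>s\<close> modulo
    \<open>p\<close>.\<close>
  define c where "c e = D w e + anchor t (inv\<^bsub>V\<^esub> val w <#\<^bsub>V\<^esub> e) - anchor s e" for e
  have c_inv: "c (inv\<^bsub>V\<^esub> val [s] <#\<^bsub>V\<^esub> e) mod int p = c e mod int p" if e: "e \<in> edges" for e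
  proof -
    have "D (w @ [t]) e = D w e + anchor t (inv\<^bsub>V\<^esub> val w <#\<^bsub>V\<^esub> e) - anchor t (inv\<^bsub>V\<^esub> (val w \<otimes>\<^bsub>V\<^esub> val [t]) <#\<^bsub>V\<^esub> e)"
      using D_append[of w "[t]" e] w st e vs by (simp add: inv_mult_act)
    moreover have "anchor t (inv\<^bsub>V\<^esub> (val w \<otimes>\<^bsub>V\<^esub> val [t]) <#\<^bsub>V\<^esub> e) = anchor t (inv\<^bsub>V\<^esub> val w <#\<^bsub>V\<^esub> (inv\<^bsub>V\<^esub> val [s] <#\<^bsub>V\<^esub> e))"
      using vs e by (simp add: inv_mult_act val)
    ultimately have "c e - c (inv\<^bsub>V\<^esub> val [s] <#\<^bsub>V\<^esub> e) = D (w @ [t]) e - D ([s] @ w) e"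
      by (simp add: c_def)
    then have "int p dvd c e - c (inv\<^bsub>V\<^esub> val [s] <#\<^bsub>V\<^esub> e)"
      using D[OF e] by (simp add: mod_eq_dvd_iff)
    then show ?thesis by (metis mod_eq_dvd_iff)
  qed
  \<comment> \<open>Only the residues of \<open>c\<close> are exactly invariant, so the orbit
    argument is applied to them; the remainder is divisible by \<open>p\<close> term by
    term.\<close>
  have "int p dvd (\<Sum>e\<in>edges. (c e mod int p) * flux ?a e)"
  proof (rule p_dvd_sum_invariant[OF p V finite_edges vs(2)])
    fix e assume e: "e \<in> edges"
    show "(c (val [s] <#\<^bsub>V\<^esub> e) mod int p) * flux ?a (val [s] <#\<^bsub>V\<^esub> e) = (c e mod int p) * flux ?a e"
      using c_inv[OF act_closed[OF vs(2) e]] act_inv_act(1)[OF vs(2) e] flux_act[OF a e] vs by simp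
    show "(c e mod int p) * flux ?a e = 0" if "val [s] <#\<^bsub>V\<^esub> e = e"
      using flux_fixed_edge[OF a e _ inj] that vs by simp
  qed
  moreover have "int p dvd (\<Sum>e\<in>edges. (c e - c e mod int p) * flux ?a e)"
    by (intro dvd_sum dvd_mult2) simp
  ultimately have "int p dvd (\<Sum>e\<in>edges. (c e - c e mod int p) * flux ?a e)
      + (\<Sum>e\<in>edges. (c e mod int p) * flux ?a e)"
    by (intro dvd_add)
  then have "int p dvd (\<Sum>e\<in>edges. c e * flux ?a e)"
    by (simp add: sum.distrib[symmetric] distrib_right[symmetric])
  moreover have "(\<Sum>e\<in>edges. c e * flux ?a e) = of_bool (val w \<in> fixed ?a (isl t)) - of_bool (\<one>\<^bsub>V\<^esub> \<in> fixed ?a (isl s))"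
  proof -
    have "(\<Sum>e\<in>edges. c e * flux ?a e) = (\<Sum>e\<in>edges. D w e * flux ?a e)
      + (\<Sum>e\<in>edges. anchor t (inv\<^bsub>V\<^esub> val w <#\<^bsub>V\<^esub> e) * flux ?a e)
      - (\<Sum>e\<in>edges. anchor s e * flux ?a e)"
      by (simp only: c_def left_diff_distrib distrib_right sum.distrib sum_subtractf)
    moreover have "(\<Sum>e\<in>edges. anchor s (inv\<^bsub>V\<^esub> \<one>\<^bsub>V\<^esub> <#\<^bsub>V\<^esub> e) * flux ?a e) = (\<Sum>e\<in>edges. anchor s e * flux ?a e)"
      by (rule sum.cong) (simp_all add: act_one)
    ultimately show ?thesis
      using sum_flux_D[OF a w] sum_flux_anchor[OF a vs(1), of t] sum_flux_anchor[OF a V.one_closed, of s] by simp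
  qed
  moreover have "\<one>\<^bsub>V\<^esub> \<in> fixed ?a (isl s)"
    unfolding fixed_def by (rule image_eqI[of _ _ "\<one>\<^bsub>G\<^esub>"]) (use a factorI[OF st(1)] in auto)
  \<comment> \<open>The start is counted, so the sum is 0 or -1; as \<open>p\<close> divides it, the
    end is counted too.\<close>
  ultimately have "val w \<in> fixed ?a (isl t)"
    using p not_prime_unit by (cases "val w \<in> fixed ?a (isl t)") auto
  then obtain g where g: "g \<in> carrier G" "val w = \<pi> g" "inv\<^bsub>G\<^esub> g \<otimes>\<^bsub>G\<^esub> ?a \<otimes>\<^bsub>G\<^esub> g \<in> factor (isl t)"
    by (auto simp: fixed_def)
  have "\<pi> (inv\<^bsub>G\<^esub> g \<otimes>\<^bsub>G\<^esub> ?a \<otimes>\<^bsub>G\<^esub> g) = inv\<^bsub>V\<^esub> val w \<otimes>\<^bsub>V\<^esub> (val w \<otimes>\<^bsub>V\<^esub> val [t])"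
    using g a vs val by (simp add: V.m_assoc)
  also have "\<dots> = val [t]" using vs(1,3) by (simp add: V.m_assoc[symmetric])
  also have "\<dots> = \<pi> (cls [t])" by (simp add: val_def)
  \<comment> \<open>Both sides lie in the same factor, where \<open>\<pi>\<close> is injective; the
    conjugacy thus holds in \<open>G\<close> itself.\<close>
  finally have "inv\<^bsub>G\<^esub> g \<otimes>\<^bsub>G\<^esub> ?a \<otimes>\<^bsub>G\<^esub> g = cls [t]"
    using inj_onD[OF inj _ g(3) factorI[OF st(2)]] by simp
  then show False using nc g(1) unfolding conjugate_in_def by metis
qed (use st in auto)

end

subsection \<open>Cyclically reduced words\<close>

lemma concat_replicate_prefix:
  assumes "concat (replicate n w) = u @ v"
  obtains q u' v' where "u = concat (replicate q w) @ u'" "w = u' @ v'"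
proof -
  have "\<exists>q u' v'. u = concat (replicate q w) @ u' \<and> w = u' @ v'"
    using assms
  proof (induction n arbitrary: u)
    case 0
    then show ?case by (intro exI[of _ 0] exI[of _ "[]"] exI[of _ w]) simp
  next
    case (Suc n)
    then have "w @ concat (replicate n w) = u @ v" by simp
    then consider r where "w = u @ r" | r where "u = w @ r" "concat (replicate n w) = r @ v"
      by (auto simp: append_eq_append_conv2)
    then show ?case
    proof cases
      case 1
      then show ?thesis by (intro exI[of _ 0]) auto
    next
      case 2
      then obtain q u' v' where "r = concat (replicate q w) @ u'" "w = u' @ v'" using Suc.IH by blast
      then show ?thesis using 2 by (intro exI[of _ "Suc q"] exI[of _ u'] exI[of _ v']) simp
    qed
  qed
  then show thesis using that by blast
qed

lemma concat_replicate_letter: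
  assumes "concat (replicate n w) = u @ s # v"
  obtains q u' v' where "u = concat (replicate q w) @ u'" "w = u' @ s # v'"
proof -
  have "\<exists>q u' v'. u = concat (replicate q w) @ u' \<and> w = u' @ s # v'"
    using assms
  proof (induction n arbitrary: u)
    case (Suc n)
    then have "w @ concat (replicate n w) = u @ s # v" by simp
    then consider r where "w = u @ s # r" | r where "u = w @ r" "concat (replicate n w) = r @ s # v"
      by (auto simp: append_eq_append_conv2 Cons_eq_append_conv append_eq_Cons_conv)
    then show ?case
    proof cases
      case 1
      then show ?thesis by (intro exI[of _ 0]) auto
    next
      case 2
      then obtain q u' v' where "r = concat (replicate q w) @ u'" "w = u' @ s # v'" using Suc.IH by blast
      then show ?thesis using 2 by (intro exI[of _ "Suc q"] exI[of _ u'] exI[of _ v']) simp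
    qed
  qed simp
  then show thesis using that by blast
qed

lemma not_successivelyE:
  assumes "\<not> successively P w"
  obtains u s t v where "w = u @ s # t # v" "\<not> P s t"
proof -
  have "\<exists>u s t v. w = u @ s # t # v \<and> \<not> P s t"
    using assms
  proof (induction w)
    case (Cons s w)
    show ?case
    proof (cases "successively P w")
      case True
      then obtain t v where "w = t # v" "\<not> P s t"
        using Cons.prems by (cases w) (auto simp: successively_Cons)
      then show ?thesis by (intro exI[of _ "[]"]) auto
    next
      case False
      then obtain u r t v where "w = u @ r # t # v" "\<not> P r t" using Cons.IH by blast
      then show ?thesis by (intro exI[of _ "s # u"]) auto
    qed
  qed simp
  then show thesis using that by blast
qed

context amalgam
begin

text \<open>Beginning in \<open>H\<close> and ending in \<open>K\<close> is a normalization that a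
  rotation achieves. It forces length at least two and makes the letters alternate also where two
  copies of the word meet.\<close>

definition cyclically_reduced :: "('h + 'k) list \<Rightarrow> bool" where
  "cyclically_reduced w \<longleftrightarrow> reduced w \<and> w \<noteq> [] \<and> isl (hd w) \<and> \<not> isl (last w)"

text \<open>With \<open>w = u @ z\<close>, cancelling \<open>u\<close> in the commutation relation
  equates \<open>\<alpha>\<close> times \<open>w\<close> with \<open>z @ u\<close> times
  \<open>\<alpha>\<close>. Both words are reduced, but \<open>w\<close> begins in \<open>H\<close>
  and \<open>z\<close> in \<open>K\<close>.\<close>

lemma cyclically_reduced_centralizer:
  assumes w: "cyclically_reduced w" "w = u @ Inr k # v" and \<alpha>: "\<alpha> \<in> A"
  shows "cls w \<otimes>\<^bsub>G\<^esub> cls (u @ [Inl \<alpha>]) \<noteq> cls (u @ [Inl \<alpha>]) \<otimes>\<^bsub>G\<^esub> cls w"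
proof
  assume eq: "cls w \<otimes>\<^bsub>G\<^esub> cls (u @ [Inl \<alpha>]) = cls (u @ [Inl \<alpha>]) \<otimes>\<^bsub>G\<^esub> cls w"
  define z where "z = Inr k # v"
  have wz: "w = u @ z" and wr: "reduced w" using w by (auto simp: z_def cyclically_reduced_def)
  have L: "u \<in> L" "z \<in> L" "w \<in> L" "Inl \<alpha> \<in> amal_letters H K"
    using wr wz \<alpha> A_sub by (auto simp: reduced_def)
  have "u \<noteq> []" using w by (auto simp: cyclically_reduced_def)
  then have "isl (hd u)" using w by (auto simp: cyclically_reduced_def)
  moreover have "\<not> isl (last z)" using w by (auto simp: cyclically_reduced_def z_def)
  ultimately have zu: "reduced (z @ u)"
    using wr wz by (auto simp: reduced_def successively_append_iff)
  have "cls u \<otimes>\<^bsub>G\<^esub> (cls z \<otimes>\<^bsub>G\<^esub> (cls u \<otimes>\<^bsub>G\<^esub> cls [Inl \<alpha>])) = cls u \<otimes>\<^bsub>G\<^esub> (cls [Inl \<alpha>] \<otimes>\<^bsub>G\<^esub> (cls u \<otimes>\<^bsub>G\<^esub> cls z))"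
    using eq L unfolding wz by (simp add: cls_append G.m_assoc)
  then have "cls z \<otimes>\<^bsub>G\<^esub> (cls u \<otimes>\<^bsub>G\<^esub> cls [Inl \<alpha>]) = cls [Inl \<alpha>] \<otimes>\<^bsub>G\<^esub> (cls u \<otimes>\<^bsub>G\<^esub> cls z)"
    using L by simp
  then have "cls (Inl \<alpha> # w) = cls ((z @ u) @ [Inl \<alpha>])"
    using L wz cls_Cons[of "Inl \<alpha>" w] by (simp add: cls_append G.m_assoc del: append_assoc)
  from reduced_type[OF wr _ zu _ \<alpha> \<alpha> this] show False
    using w by (auto simp: cyclically_reduced_def z_def)
qed

lemma merge_letters:
  assumes "s \<in> amal_letters H K" "t \<in> amal_letters H K" "isl s = isl t"
  obtains r where "r \<in> amal_letters H K" "([s, t], [r]) \<in> R"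
proof (cases s)
  case (Inl h)
  then obtain h' where "t = Inl h'" using assms by (cases t) auto
  then show thesis
    using that[of "Inl (h \<otimes>\<^bsub>H\<^esub> h')"] amal_rel.multH[of h H h' K A \<phi>] Inl assms by simp
next
  case (Inr h)
  then obtain h' where "t = Inr h'" using assms by (cases t) auto
  then show thesis
    using that[of "Inr (h \<otimes>\<^bsub>K\<^esub> h')"] amal_rel.multK[of h K h' H A \<phi>] Inr assms by simp
qed

lemma swap_letter:
  assumes "s \<in> Inl ` A \<union> Inr ` B"
  obtains s' where "s' \<in> amal_letters H K" "isl s' \<noteq> isl s" "([s], [s']) \<in> R"
proof (cases s)
  case (Inl a)
  then have "a \<in> A" using assms by auto
  then show thesis using that[of "Inr (\<phi> a)"] amal_rel.amal[of a A \<phi> H K] B_sub \<phi>_mem Inl by simp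
next
  case (Inr b)
  then have "b \<in> B" using assms by auto
  then obtain a where "a \<in> A" "b = \<phi> a" using \<phi>_surj by blast
  then show thesis
    using that[of "Inl a"] amal_rel.sym[OF amal_rel.amal[of a A \<phi> H K]] A_sub Inr by simp
qed

lemma conjugate_rotate:
  assumes "u \<in> L" "v \<in> L"
  shows "conjugate_in G (cls (u @ v)) (cls (v @ u))"
  unfolding conjugate_in_def
  by (rule bexI[of _ "cls u"]) (use assms in \<open>simp_all add: cls_append G.m_assoc[symmetric]\<close>)

text \<open>A shortest word representing a conjugate of \<open>g\<close> is taken. If it has at
  least two letters, any failure to be reduced can be rotated to the front and leads to a shorter
  word.\<close>

lemma conjugate_cyclically_reduced:
  assumes g: "g \<in> carrier G"
  obtains s where "s \<in> amal_letters H K" "conjugate_in G g (cls [s])"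
  | w where "cyclically_reduced w" "conjugate_in G g (cls w)"
proof -
  define P where "P w \<longleftrightarrow> w \<in> L \<and> conjugate_in G g (cls w)" for w
  from g obtain w0 where "w0 \<in> L" "g = cls w0" by (auto simp: carrier_G)
  then have "P w0" using conjugate_in_refl[OF group_G g] by (simp add: P_def)
  then obtain w where w: "P w" and least: "\<And>v. P v \<Longrightarrow> length w \<le> length v"
    using ex_has_least_nat[of P w0 length] by blast
  have rotate: "P (v @ u)" if "P (u @ v)" for u v
    using that conjugate_in_trans[OF group_G g _ conjugate_rotate[of u v]] by (auto simp: P_def)
  have replace: "P (u' @ v)" if "P (u @ v)" "(u, u') \<in> R" for u u' v
  proof -
    have "v \<in> L" "u' \<in> L" using that rel_words[OF that(2)] by (auto simp: P_def)
    then have "cls (u @ v) = cls (u' @ v)" using rel_append[OF that(2) amal_rel.refl] cls_eqI by blast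
    then show ?thesis using that \<open>v \<in> L\<close> \<open>u' \<in> L\<close> by (auto simp: P_def)
  qed
  have alt: "isl s \<noteq> isl t" if st: "P (s # t # v)" "length (s # t # v) = length w" for s t v
  proof
    assume "isl s = isl t"
    moreover have "s \<in> amal_letters H K" "t \<in> amal_letters H K" using st by (auto simp: P_def)
    ultimately obtain r where "([s, t], [r]) \<in> R" using merge_letters by metis
    then have "P (r # v)" using replace[of "[s, t]" v "[r]"] st by simp
    then show False using least[of "r # v"] st by simp
  qed
  \<comment> \<open>A letter of the amalgamated subgroup can be rewritten in the other factor; one
    of the two forms has the type of its neighbour, contrary to \<open>alt\<close>.\<close>
  have letter: "s \<notin> Inl ` A \<union> Inr ` B" if st: "P (s # t # v)" "length (s # t # v) = length w" for s t v
  proof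
    assume "s \<in> Inl ` A \<union> Inr ` B"
    then obtain s' where s': "isl s' \<noteq> isl s" "([s], [s']) \<in> R" using swap_letter by metis
    then have "P (s' # t # v)" using replace[of "[s]" "t # v" "[s']"] st by simp
    then have "isl s' \<noteq> isl t" using alt st by simp
    then show False using alt[OF st] s' by simp
  qed
  consider "length w = 0" | "length w = 1" | "length w \<ge> 2" by linarith
  then show thesis
  proof cases
    case 1
    have "cls [Inl \<one>\<^bsub>H\<^esub>] = cls []" by (rule cls_eqI[OF amal_rel.oneH])
    then show ?thesis using 1 w that(1)[of "Inl \<one>\<^bsub>H\<^esub>"] by (simp add: P_def)
  next
    case 2
    then obtain s where "w = [s]" by (auto simp: length_Suc_conv)
    then show ?thesis using w that(1)[of s] by (simp add: P_def)
  next
    case 3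
    have red: "reduced v" if v: "P v" "length v = length w" for v
      unfolding reduced_def
    proof (intro conjI)
      show "v \<in> L" using v by (simp add: P_def)
      show "successively (\<lambda>s t. isl s \<noteq> isl t) v"
      proof (rule ccontr)
        assume "\<not> successively (\<lambda>s t. isl s \<noteq> isl t) v"
        then obtain x s t y where x: "v = x @ s # t # y" "isl s = isl t" by (rule not_successivelyE) auto
        then show False using alt[of s t "y @ x"] rotate[of x "s # t # y"] v by simp
      qed
      have "s \<notin> Inl ` A \<union> Inr ` B" if s: "s \<in> set v" for s
      proof -
        from s obtain x y where x: "v = x @ s # y" by (auto simp: in_set_conv_decomp)
        then have Ps: "P (s # y @ x)" using rotate[of x "s # y"] v by simp
        obtain t z where "y @ x = t # z" using x v 3 by (cases "y @ x") auto
        then show ?thesis using letter[of s t z] Ps x v by (metis length_append length_Cons add.commute append_Cons)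
      qed
      then show "set v \<inter> (Inl ` A \<union> Inr ` B) = {}" by blast
    qed
    obtain s t m where stm: "w = s # t # m" using 3 by (cases w; cases "tl w") auto
    show ?thesis
    proof (cases "isl s")
      case True
      \<comment> \<open>Moving the last letter to the front makes it a neighbour of
        \<open>s\<close>, so \<open>alt\<close> shows that it lies in \<open>K\<close>.\<close>
      have "P (last (t # m) # s # butlast (t # m))"
      proof -
        have "w = (s # butlast (t # m)) @ [last (t # m)]"
          using stm append_butlast_last_id[of "t # m"] by (simp del: butlast.simps last.simps)
        then show ?thesis using rotate[of "s # butlast (t # m)" "[last (t # m)]"] w by (simp del: butlast.simps last.simps)
      qed
      then have "\<not> isl (last (t # m))" using alt[of "last (t # m)" s] True stm by auto
      then have "cyclically_reduced w" using red[OF w] stm True by (simp add: cyclically_reduced_def)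
      then show ?thesis using that(2) w by (auto simp: P_def)
    next
      case False
      have P': "P (t # m @ [s])" using rotate[of "[s]" "t # m"] w stm by simp
      moreover have "isl t" using alt[of s t m] w stm False by simp
      ultimately have "cyclically_reduced (t # m @ [s])"
        using red[OF P'] stm False by (simp add: cyclically_reduced_def)
      then show ?thesis using that(2) P' by (auto simp: P_def)
    qed
  qed
qed

end

section \<open>Paths of cyclically reduced words in the quotient graph\<close>

context amalgam_quotient
begin

text \<open>Only a letter of \<open>K\<close> moves the path: out along the edge of
  \<open>w\<close>, back along the edge of \<open>w @ [s]\<close>.\<close>

lemma D_snoc:
  assumes "s \<in> amal_letters H K" "w \<in> L" "e \<in> edges"
  shows "D (w @ [s]) e = D w e + of_bool (\<not> isl s \<and> e = val w <#\<^bsub>V\<^esub> A')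
    - of_bool (\<not> isl s \<and> e = val (w @ [s]) <#\<^bsub>V\<^esub> A')"
proof -
  have v: "val w \<in> carrier V" "val [s] \<in> carrier V" "val (w @ [s]) = val w \<otimes>\<^bsub>V\<^esub> val [s]"
    using assms val_append[of w "[s]"] by auto
  have "D (w @ [s]) e = D w e + (anchor s (inv\<^bsub>V\<^esub> val w <#\<^bsub>V\<^esub> e) - anchor s (inv\<^bsub>V\<^esub> val (w @ [s]) <#\<^bsub>V\<^esub> e))"
    using D_append[of w "[s]" e] assms v by (simp add: inv_mult_act)
  then show ?thesis using assms v by (cases s) (auto simp: base_translate)
qed

lemma D_nonzero:
  assumes "w \<in> L" "e \<in> edges" "D w e \<noteq> 0"
  shows "\<exists>u v. w = u @ v \<and> e = val u <#\<^bsub>V\<^esub> A'"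
  using assms(1,3)
proof (induction w rule: rev_induct)
  case (snoc s w)
  then have s: "s \<in> amal_letters H K" "w \<in> L" by auto
  consider "D w e \<noteq> 0" | "e = val w <#\<^bsub>V\<^esub> A'" | "e = val (w @ [s]) <#\<^bsub>V\<^esub> A'"
    using snoc.prems(2) D_snoc[OF s assms(2)] by (auto simp: of_bool_def split: if_splits)
  then show ?case
  proof cases
    case 1
    then show ?thesis using snoc.IH[OF s(2)] by (metis append.assoc)
  next
    case 2
    then show ?thesis by blast
  next
    case 3
    then show ?thesis by (intro exI[of _ "w @ [s]"] exI[of _ "[]"]) simp
  qed
qed simp

lemma A'_eq_coset:
  assumes "x \<in> carrier V"
  shows "A' = x <#\<^bsub>V\<^esub> A' \<longleftrightarrow> x \<in> A'"
  using coset_eq_iff[of "\<one>\<^bsub>V\<^esub>" x] assms V.lcos_mult_one[OF A'_sub] by simp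

text \<open>By \<open>D_snoc\<close> the base edge is entered positively only before a letter of
  \<open>K\<close> whose prefix has its value in \<open>A'\<close>, which is excluded. Negative
  contributions remain possible, and a last letter from \<open>K\<close> yields one if the whole
  word has its value in \<open>A'\<close>.\<close>

lemma D_at_A'_nonpos:
  assumes "w \<in> L" "\<And>u k v. w = u @ Inr k # v \<Longrightarrow> val u \<notin> A'"
  shows "D w A' \<le> 0 \<and> (w \<noteq> [] \<and> \<not> isl (last w) \<and> val w \<in> A' \<longrightarrow> D w A' < 0)"
  using assms
proof (induction w rule: rev_induct)
  case (snoc s w)
  then have s: "s \<in> amal_letters H K" "w \<in> L" by auto
  have "D w A' \<le> 0" using snoc.IH[OF s(2)] snoc.prems(2) by (metis append.assoc append_Cons)
  moreover have "isl s \<or> val w \<notin> A'" using snoc.prems(2)[of w _ "[]"] by (cases s) auto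
  moreover have "val w \<in> carrier V" "val (w @ [s]) \<in> carrier V" using s by auto
  ultimately show ?case using D_snoc[OF s A'_edge] by (auto simp: A'_eq_coset)
qed simp

lemma power_word:
  assumes "w \<in> L"
  shows "concat (replicate n w) \<in> L" "val (concat (replicate n w)) = val w [^]\<^bsub>V\<^esub> n"
proof -
  show L: "concat (replicate n w) \<in> L" for n using assms by (induction n) auto
  show "val (concat (replicate n w)) = val w [^]\<^bsub>V\<^esub> n"
  proof (induction n)
    case (Suc n)
    have "val w [^]\<^bsub>V\<^esub> Suc n = val w \<otimes>\<^bsub>V\<^esub> val w [^]\<^bsub>V\<^esub> n"
      by (rule V.nat_pow_Suc2) (use assms in simp)
    then show ?case using Suc val_append[OF assms L[of n]] by simp
  qed simp
qed

text \<open>\<open>sep_a\<close> keeps the powers of \<open>wa\<close> from passing the base edge in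
  the positive direction. \<open>sep_b\<close> excludes the finitely many conjugators to which all
  others are reduced.\<close>

lemma p_separated_cyclically_reduced:
  assumes p: "Factorial_Ring.prime (p :: nat)" and V: "finite_p_group p V"
    and wa: "wa \<in> L" "wa \<noteq> []" "\<not> isl (last wa)" and wb: "wb \<in> L"
    and sep_a: "\<And>u k v \<alpha>. wa = u @ Inr k # v \<Longrightarrow> \<alpha> \<in> A \<Longrightarrow>
       val wa \<otimes>\<^bsub>V\<^esub> val (u @ [Inl \<alpha>]) \<noteq> val (u @ [Inl \<alpha>]) \<otimes>\<^bsub>V\<^esub> val wa"
    and sep_b: "\<And>u v \<alpha>. wb = u @ v \<Longrightarrow> \<alpha> \<in> A \<Longrightarrow>
       val wb \<otimes>\<^bsub>V\<^esub> val (u @ [Inl \<alpha>]) \<noteq> val (u @ [Inl \<alpha>]) \<otimes>\<^bsub>V\<^esub> val wa"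
  shows "p_separated p G (cls wa) (cls wb)"
proof -
  obtain j where j: "\<And>x. x \<in> carrier V \<Longrightarrow> x [^]\<^bsub>V\<^esub> (p ^ j :: nat) = \<one>\<^bsub>V\<^esub>"
    using finite_p_group_exponent[OF V] by blast
  define n where "n = p ^ j"
  have n: "n > 0" using p by (simp add: n_def prime_gt_0_nat)
  define pw where "pw m w = concat (replicate m w)" for m and w :: "('h + 'k) list"
  have pwL: "pw m w \<in> L" "val (pw m w) = val w [^]\<^bsub>V\<^esub> m" if "w \<in> L" for m w
    using power_word[OF that] by (simp_all add: pw_def)
  have vw: "val wa \<in> carrier V" "val wb \<in> carrier V" using wa wb by auto
  \<comment> \<open>Such a prefix is a power \<open>q\<close> of \<open>wa\<close> followed by a
    prefix \<open>u'\<close> of \<open>wa\<close>. If its value were that of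
    \<open>\<alpha>\<close>, then \<open>u'\<close> times the inverse of \<open>\<alpha>\<close>
    would have the value of a power of \<open>wa\<close> and so commute with \<open>wa\<close>,
    against \<open>sep_a\<close>.\<close>
  have odd: "val u \<notin> A'" if u: "pw n wa = u @ Inr k # v" for u k v
  proof
    assume "val u \<in> A'"
    then obtain \<alpha> where \<alpha>: "\<alpha> \<in> A" "val u = val [Inl \<alpha>]" by (auto simp: A'_def)
    obtain q u' v' where q: "u = pw q wa @ u'" "wa = u' @ Inr k # v'"
      using concat_replicate_letter u unfolding pw_def by metis
    define \<beta> where "\<beta> = inv\<^bsub>H\<^esub> \<alpha>"
    have \<beta>: "\<beta> \<in> A" using subgroup.m_inv_closed[OF A \<alpha>(1)] by (simp add: \<beta>_def)
    have L: "u' \<in> L" "Inl \<alpha> \<in> amal_letters H K" "Inl \<beta> \<in> amal_letters H K"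
      using wa(1) q(2) \<alpha> \<beta> A_sub by auto
    then have c: "val u' \<in> carrier V" "val [Inl \<alpha>] \<in> carrier V" "val [Inl \<beta>] \<in> carrier V" by auto
    have "cls [Inl \<beta>] = inv\<^bsub>G\<^esub> cls [Inl \<alpha>]" using cls_letter_inv[OF L(2)] by (simp add: \<beta>_def)
    then have \<beta>': "val [Inl \<beta>] = inv\<^bsub>V\<^esub> val [Inl \<alpha>]" using L(2) by (simp add: val_def)
    let ?y = "val (u' @ [Inl \<beta>])"
    have y: "?y = val u' \<otimes>\<^bsub>V\<^esub> inv\<^bsub>V\<^esub> val [Inl \<alpha>]" using val_append[of u' "[Inl \<beta>]"] L \<beta>' by simp
    have yc: "?y \<in> carrier V" using y c by simp
    have "val wa [^]\<^bsub>V\<^esub> q \<otimes>\<^bsub>V\<^esub> val u' = val [Inl \<alpha>]"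
      using \<alpha>(2) q(1) val_append[of "pw q wa" u'] pwL[OF wa(1)] L by simp
    then have "val wa [^]\<^bsub>V\<^esub> q \<otimes>\<^bsub>V\<^esub> ?y = \<one>\<^bsub>V\<^esub>"
      using y c vw by (simp add: V.m_assoc[symmetric])
    then have yq: "?y = inv\<^bsub>V\<^esub> (val wa [^]\<^bsub>V\<^esub> q)"
      using yc vw V.inv_solve_left[of "\<one>\<^bsub>V\<^esub>"] by (metis V.inv_comm V.inv_equality V.nat_pow_closed)
    have "val wa [^]\<^bsub>V\<^esub> q \<otimes>\<^bsub>V\<^esub> val wa = val wa \<otimes>\<^bsub>V\<^esub> val wa [^]\<^bsub>V\<^esub> q"
      using vw by (metis V.nat_pow_Suc V.nat_pow_Suc2)
    then have "inv\<^bsub>V\<^esub> (val wa [^]\<^bsub>V\<^esub> q) \<otimes>\<^bsub>V\<^esub> (val wa [^]\<^bsub>V\<^esub> q \<otimes>\<^bsub>V\<^esub> val wa) \<otimes>\<^bsub>V\<^esub> inv\<^bsub>V\<^esub> (val wa [^]\<^bsub>V\<^esub> q)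
      = inv\<^bsub>V\<^esub> (val wa [^]\<^bsub>V\<^esub> q) \<otimes>\<^bsub>V\<^esub> (val wa \<otimes>\<^bsub>V\<^esub> val wa [^]\<^bsub>V\<^esub> q) \<otimes>\<^bsub>V\<^esub> inv\<^bsub>V\<^esub> (val wa [^]\<^bsub>V\<^esub> q)"
      by simp
    moreover have "inv\<^bsub>V\<^esub> (val wa [^]\<^bsub>V\<^esub> q) \<otimes>\<^bsub>V\<^esub> (val wa [^]\<^bsub>V\<^esub> q \<otimes>\<^bsub>V\<^esub> val wa) = val wa"
      using vw by (simp add: V.m_assoc[symmetric])
    moreover have "inv\<^bsub>V\<^esub> (val wa [^]\<^bsub>V\<^esub> q) \<otimes>\<^bsub>V\<^esub> (val wa \<otimes>\<^bsub>V\<^esub> val wa [^]\<^bsub>V\<^esub> q) \<otimes>\<^bsub>V\<^esub> inv\<^bsub>V\<^esub> (val wa [^]\<^bsub>V\<^esub> q)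
      = inv\<^bsub>V\<^esub> (val wa [^]\<^bsub>V\<^esub> q) \<otimes>\<^bsub>V\<^esub> val wa"
      using vw by (simp add: V.m_assoc)
    ultimately have "val wa \<otimes>\<^bsub>V\<^esub> ?y = ?y \<otimes>\<^bsub>V\<^esub> val wa" using yq by simp
    then show False using sep_a[OF q(2) \<beta>] by simp
  qed
  have neg: "D (pw n wa) A' < 0"
  proof -
    obtain m where "n = Suc m" using n by (cases n) auto
    then have "pw n wa = pw m wa @ wa"
      by (simp add: pw_def replicate_append_same[symmetric])
    then have "pw n wa \<noteq> []" "last (pw n wa) = last wa" using wa by auto
    moreover have "val (pw n wa) \<in> A'"
      using pwL[OF wa(1), of n] j[OF vw(1)] subgroup.one_closed[OF subgroup_A'] by (simp add: n_def)
    ultimately show ?thesis using D_at_A'_nonpos[OF pwL(1)[OF wa(1)] odd] wa(3) by auto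
  qed
  \<comment> \<open>The modulus is chosen larger than the absolute value of the coefficient, which
    thus stays nonzero modulo \<open>p ^ k\<close>.\<close>
  define k where "k = nat (- D (pw n wa) A')"
  have k: "- D (pw n wa) A' < int (p ^ k)"
  proof -
    have "k < 2 ^ k" by (rule less_exp)
    also have "(2 :: nat) ^ k \<le> p ^ k" using prime_ge_2_nat[OF p] by (rule power_mono) simp
    finally have "int k < int (p ^ k)" by (simp only: of_nat_less_iff)
    then show ?thesis using neg by (simp add: k_def)
  qed
  show ?thesis
  proof (rule p_separated_by_deriv[OF p V wa(1) wb, where k = k])
    fix w assume w: "w \<in> L" and val: "val w \<otimes>\<^bsub>V\<^esub> val wb = val wa \<otimes>\<^bsub>V\<^esub> val w"
      and D: "\<And>e. e \<in> edges \<Longrightarrow> D (w @ wb) e mod int (p ^ k) = D (wa @ w) e mod int (p ^ k)"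
    have vwc: "val w \<in> carrier V" using w by simp
    \<comment> \<open>The congruence between \<open>w @ wb\<close> and \<open>wa @ w\<close> is
      passed on to powers by moving one copy of \<open>wa\<close> across at a time.\<close>
    have Dpow: "int (p ^ k) dvd D (w @ pw m wb) e - D (pw m wa @ w) e" if "e \<in> edges" for m e
      using that
    proof (induction m arbitrary: e)
      case 0
      then show ?case by (simp add: pw_def)
    next
      case (Suc m)
      have e': "inv\<^bsub>V\<^esub> val wa <#\<^bsub>V\<^esub> e \<in> edges" using act_closed vw Suc.prems by simp
      have "D (w @ pw (Suc m) wb) e = D ((w @ wb) @ pw m wb) e" by (simp add: pw_def)
      also have "\<dots> = D (w @ wb) e + D (pw m wb) (inv\<^bsub>V\<^esub> val (w @ wb) <#\<^bsub>V\<^esub> e)"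
        by (rule D_append) (use w wb pwL(1)[OF wb] Suc.prems in auto)
      also have "val (w @ wb) = val (wa @ w)" using val w wa wb by (simp add: val_append)
      finally have 1: "D (w @ pw (Suc m) wb) e = D (w @ wb) e + D (pw m wb) (inv\<^bsub>V\<^esub> val (wa @ w) <#\<^bsub>V\<^esub> e)" .
      have "D (wa @ (w @ pw m wb)) e = D ((wa @ w) @ pw m wb) e" by simp
      also have "\<dots> = D (wa @ w) e + D (pw m wb) (inv\<^bsub>V\<^esub> val (wa @ w) <#\<^bsub>V\<^esub> e)"
        by (rule D_append) (use w wa pwL(1)[OF wb] Suc.prems in auto)
      finally have 2: "D (wa @ (w @ pw m wb)) e = D (wa @ w) e + D (pw m wb) (inv\<^bsub>V\<^esub> val (wa @ w) <#\<^bsub>V\<^esub> e)" .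
      have 3: "D (wa @ (w @ pw m wb)) e = D wa e + D (w @ pw m wb) (inv\<^bsub>V\<^esub> val wa <#\<^bsub>V\<^esub> e)"
        by (rule D_append) (use w wa pwL(1)[OF wb] Suc.prems in auto)
      have "D (pw (Suc m) wa @ w) e = D (wa @ (pw m wa @ w)) e" by (simp add: pw_def)
      also have "\<dots> = D wa e + D (pw m wa @ w) (inv\<^bsub>V\<^esub> val wa <#\<^bsub>V\<^esub> e)"
        by (rule D_append) (use w wa pwL(1)[OF wa(1)] Suc.prems in auto)
      finally have 4: "D (pw (Suc m) wa @ w) e = D wa e + D (pw m wa @ w) (inv\<^bsub>V\<^esub> val wa <#\<^bsub>V\<^esub> e)" .
      have "int (p ^ k) dvd (D (w @ wb) e - D (wa @ w) e)
        + (D (w @ pw m wb) (inv\<^bsub>V\<^esub> val wa <#\<^bsub>V\<^esub> e) - D (pw m wa @ w) (inv\<^bsub>V\<^esub> val wa <#\<^bsub>V\<^esub> e))"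
        using D[OF Suc.prems] Suc.IH[OF e'] by (intro dvd_add) (simp_all add: mod_eq_dvd_iff)
      moreover have "D (w @ pw (Suc m) wb) e - D (pw (Suc m) wa @ w) e = (D (w @ wb) e - D (wa @ w) e)
        + (D (w @ pw m wb) (inv\<^bsub>V\<^esub> val wa <#\<^bsub>V\<^esub> e) - D (pw m wa @ w) (inv\<^bsub>V\<^esub> val wa <#\<^bsub>V\<^esub> e))"
        using 1 2 3 4 by linarith
      ultimately show ?case by (simp only:)
    qed
    have one: "val (pw n wa) = \<one>\<^bsub>V\<^esub>" using pwL[OF wa(1)] j vw by (simp add: n_def)
    let ?e = "inv\<^bsub>V\<^esub> val w <#\<^bsub>V\<^esub> A'"
    have e: "?e \<in> edges" using vwc by (intro coset_edge) simp
    have "D (w @ pw n wb) A' = D w A' + D (pw n wb) ?e"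
      by (rule D_append[OF w pwL(1)[OF wb] A'_edge])
    moreover have "D (pw n wa @ w) A' = D (pw n wa) A' + D w A'"
      using D_append[OF pwL(1)[OF wa(1)] w A'_edge, of n] one act_one[OF A'_edge] by simp
    \<comment> \<open>The value of the power of \<open>wa\<close> is trivial, so
      \<open>D w A'\<close> occurs on both sides and cancels. The coefficient of the power of
      \<open>wb\<close> at the translated edge is thus congruent to that of the power of
      \<open>wa\<close> at the base edge.\<close>
    ultimately have dv: "int (p ^ k) dvd D (pw n wb) ?e - D (pw n wa) A'"
      using Dpow[OF A'_edge, of n] by simp
    have "D (pw n wb) ?e \<noteq> 0"
    proof
      assume "D (pw n wb) ?e = 0"
      then have "int (p ^ k) dvd - D (pw n wa) A'" using dv by simp
      then show False using zdvd_imp_le[of "int (p ^ k)" "- D (pw n wa) A'"] neg k by simp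
    qed
    then obtain u r where u: "pw n wb = u @ r" "?e = val u <#\<^bsub>V\<^esub> A'"
      using D_nonzero[OF pwL(1)[OF wb] e] by blast
    obtain q u' v' where q: "u = pw q wb @ u'" "wb = u' @ v'"
      using concat_replicate_prefix u(1) unfolding pw_def by metis
    have L: "u' \<in> L" using wb q(2) by auto
    have uc: "val u' \<in> carrier V" "val u = val wb [^]\<^bsub>V\<^esub> q \<otimes>\<^bsub>V\<^esub> val u'"
      using L q(1) val_append[of "pw q wb" u'] pwL[OF wb] by auto
    have "inv\<^bsub>V\<^esub> val u \<otimes>\<^bsub>V\<^esub> inv\<^bsub>V\<^esub> val w \<in> A'"
      using coset_eq_iff[of "val u" "inv\<^bsub>V\<^esub> val w"] u(2) uc vwc vw by simp
    then obtain \<alpha> where \<alpha>: "\<alpha> \<in> A" "inv\<^bsub>V\<^esub> val u \<otimes>\<^bsub>V\<^esub> inv\<^bsub>V\<^esub> val w = val [Inl \<alpha>]" by (auto simp: A'_def)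
    let ?y = "val (u' @ [Inl \<alpha>])"
    have Ac: "Inl \<alpha> \<in> amal_letters H K" "val [Inl \<alpha>] \<in> carrier V" using \<alpha>(1) A_sub by auto
    have y: "?y = val u' \<otimes>\<^bsub>V\<^esub> val [Inl \<alpha>]" "?y \<in> carrier V"
      using val_append[of u' "[Inl \<alpha>]"] L Ac uc by auto
    have "val u \<otimes>\<^bsub>V\<^esub> val [Inl \<alpha>] = inv\<^bsub>V\<^esub> val w"
      unfolding \<alpha>(2)[symmetric] using uc vw vwc by (simp add: V.m_assoc[symmetric])
    \<comment> \<open>The inverse of \<open>w\<close> is a power of \<open>wb\<close> times
      \<open>?y\<close>. That power commutes with \<open>wb\<close>, so \<open>?y\<close> alone
      relates \<open>wb\<close> and \<open>wa\<close> in the way that \<open>sep_b\<close>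
      forbids.\<close>
    then have wy: "inv\<^bsub>V\<^esub> val w = val wb [^]\<^bsub>V\<^esub> q \<otimes>\<^bsub>V\<^esub> ?y"
      using uc y Ac vw by (simp add: V.m_assoc)
    have "inv\<^bsub>V\<^esub> val w \<otimes>\<^bsub>V\<^esub> (val wa \<otimes>\<^bsub>V\<^esub> val w) \<otimes>\<^bsub>V\<^esub> inv\<^bsub>V\<^esub> val w = inv\<^bsub>V\<^esub> val w \<otimes>\<^bsub>V\<^esub> val wa"
      using vw vwc by (simp add: V.m_assoc)
    moreover have "inv\<^bsub>V\<^esub> val w \<otimes>\<^bsub>V\<^esub> (val w \<otimes>\<^bsub>V\<^esub> val wb) \<otimes>\<^bsub>V\<^esub> inv\<^bsub>V\<^esub> val w = val wb \<otimes>\<^bsub>V\<^esub> inv\<^bsub>V\<^esub> val w"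
      using vw vwc by (simp add: V.m_assoc[symmetric])
    ultimately have "val wb \<otimes>\<^bsub>V\<^esub> inv\<^bsub>V\<^esub> val w = inv\<^bsub>V\<^esub> val w \<otimes>\<^bsub>V\<^esub> val wa" using val by simp
    then have "val wb \<otimes>\<^bsub>V\<^esub> (val wb [^]\<^bsub>V\<^esub> q \<otimes>\<^bsub>V\<^esub> ?y) = val wb [^]\<^bsub>V\<^esub> q \<otimes>\<^bsub>V\<^esub> ?y \<otimes>\<^bsub>V\<^esub> val wa"
      unfolding wy .
    moreover have "val wb \<otimes>\<^bsub>V\<^esub> (val wb [^]\<^bsub>V\<^esub> q \<otimes>\<^bsub>V\<^esub> ?y) = val wb [^]\<^bsub>V\<^esub> q \<otimes>\<^bsub>V\<^esub> (val wb \<otimes>\<^bsub>V\<^esub> ?y)"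
    proof -
      have "val wb \<otimes>\<^bsub>V\<^esub> val wb [^]\<^bsub>V\<^esub> q = val wb [^]\<^bsub>V\<^esub> q \<otimes>\<^bsub>V\<^esub> val wb"
        using vw by (metis V.nat_pow_Suc V.nat_pow_Suc2)
      then show ?thesis using vw y by (simp add: V.m_assoc[symmetric])
    qed
    ultimately have "val wb [^]\<^bsub>V\<^esub> q \<otimes>\<^bsub>V\<^esub> (val wb \<otimes>\<^bsub>V\<^esub> ?y) = val wb [^]\<^bsub>V\<^esub> q \<otimes>\<^bsub>V\<^esub> (?y \<otimes>\<^bsub>V\<^esub> val wa)"
      using vw y(2) by (simp add: V.m_assoc)
    then have "val wb \<otimes>\<^bsub>V\<^esub> ?y = ?y \<otimes>\<^bsub>V\<^esub> val wa" using vw y(2) by simp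
    then show False using sep_b[OF q(2) \<alpha>(1)] by simp
  qed
qed

end

section \<open>Choice of the quotient and reduction to normalized words\<close>

context amalgam
begin

lemma p_separated_factors:
  assumes p: "Factorial_Ring.prime (p :: nat)" and res: "residually_p p G"
    and fin: "finite (carrier H)" "finite (carrier K)"
    and st: "s \<in> amal_letters H K" "t \<in> amal_letters H K"
    and nc: "\<not> conjugate_in G (cls [s]) (cls [t])"
  shows "p_separated p G (cls [s]) (cls [t])"
proof -
  \<comment> \<open>Keeping these finitely many quotients nontrivial amounts to injectivity on each
    factor.\<close>
  define S where "S = (\<lambda>(x, y). x \<otimes>\<^bsub>G\<^esub> inv\<^bsub>G\<^esub> y) ` (factor True \<times> factor True \<union> factor False \<times> factor False)"
  have "finite (amal_letters H K)" using fin by (simp add: amal_letters_def)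
  then have "finite (factor q)" for q by (simp add: factor_def)
  then have "finite S" by (simp add: S_def)
  have sub: "x \<in> carrier G" if "x \<in> factor q" for x q
    using subgroup.mem_carrier[OF subgroup_factor that] .
  have S_sub: "S \<subseteq> carrier G" by (auto simp: S_def dest: sub)
  obtain V :: "('h + 'k) list set set monoid" and \<pi> where V: "finite_p_group p V" "\<pi> \<in> hom G V"
    "\<forall>s\<in>S. \<pi> s = \<one>\<^bsub>V\<^esub> \<longrightarrow> s = \<one>\<^bsub>G\<^esub>"
    using residually_p_finite_set[OF group_G p res \<open>finite S\<close> S_sub]
    by (elim exE conjE) (rule that)
  interpret Q: amalgam_quotient H K A B \<phi> V \<pi>
    using V(1,2)
    by (intro amalgam_quotient.intro amalgam_axioms amalgam_quotient_axioms.intro)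
      (auto simp: finite_p_group_def)
  have "inj_on \<pi> (factor q)" for q
  proof (rule inj_onI)
    fix x y assume xy: "x \<in> factor q" "y \<in> factor q" "\<pi> x = \<pi> y"
    then have "x \<otimes>\<^bsub>G\<^esub> inv\<^bsub>G\<^esub> y \<in> S" by (cases q) (auto simp: S_def)
    moreover have "\<pi> (x \<otimes>\<^bsub>G\<^esub> inv\<^bsub>G\<^esub> y) = \<one>\<^bsub>V\<^esub>" using xy sub by simp
    ultimately have "x \<otimes>\<^bsub>G\<^esub> inv\<^bsub>G\<^esub> y = \<one>\<^bsub>G\<^esub>" using V(3) by blast
    then show "x = y" using G.inv_solve_right'[of "\<one>\<^bsub>G\<^esub>" x y] sub xy by simp
  qed
  then show ?thesis using Q.p_separated_factor[OF p V(1) _ st nc] by blast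
qed

lemma p_separated_reduced:
  assumes p: "Factorial_Ring.prime (p :: nat)" and res: "residually_p p G"
    and fin: "finite (carrier H)"
    and wa: "cyclically_reduced wa" and wb: "wb \<in> L"
    and nc: "\<not> conjugate_in G (cls wa) (cls wb)"
  shows "p_separated p G (cls wa) (cls wb)"
proof -
  \<comment> \<open>The products of a prefix and an amalgamated element; indexing prefixes by length
    makes the set visibly finite.\<close>
  define Y where "Y w = (\<lambda>(i, \<alpha>). cls (take i w @ [Inl \<alpha>])) ` ({..length w} \<times> A)" for w
  have "finite A" using fin subgroup.subset[OF A] finite_subset by blast
  then have finY: "finite (Y w)" for w by (simp add: Y_def)
  have subY: "y \<in> carrier G" if "w \<in> L" "y \<in> Y w" for y w
    using that A_sub by (auto simp: Y_def in_lists_conv_set dest!: in_set_takeD intro!: cls_closed)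
  have memY: "cls (u @ [Inl \<alpha>]) \<in> Y (u @ v)" if "\<alpha> \<in> A" for u v \<alpha>
    unfolding Y_def using that by (intro image_eqI[of _ _ "(length u, \<alpha>)"]) auto
  have waL: "wa \<in> L" using wa by (simp add: cyclically_reduced_def reduced_def)
  have ab: "cls wa \<in> carrier G" "cls wb \<in> carrier G" using waL wb by auto
  \<comment> \<open>\<open>f c y\<close> is trivial precisely when \<open>y\<close> conjugates
    \<open>c\<close> to \<open>cls wa\<close>. Some elements of \<open>S\<close> may be trivial,
    which is harmless, since \<open>\<pi>\<close> only has to preserve nontriviality.\<close>
  define f where "f c y = inv\<^bsub>G\<^esub> (y \<otimes>\<^bsub>G\<^esub> cls wa) \<otimes>\<^bsub>G\<^esub> (c \<otimes>\<^bsub>G\<^esub> y)" for c y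
  define S where "S = f (cls wa) ` Y wa \<union> f (cls wb) ` Y wb"
  have "finite S" using finY by (simp add: S_def)
  have S_sub: "S \<subseteq> carrier G" using ab subY[OF waL] subY[OF wb] by (auto simp: S_def f_def)
  obtain V :: "('h + 'k) list set set monoid" and \<pi> where V: "finite_p_group p V" "\<pi> \<in> hom G V"
    "\<forall>s\<in>S. \<pi> s = \<one>\<^bsub>V\<^esub> \<longrightarrow> s = \<one>\<^bsub>G\<^esub>"
    using residually_p_finite_set[OF group_G p res \<open>finite S\<close> S_sub]
    by (elim exE conjE) (rule that)
  interpret Q: amalgam_quotient H K A B \<phi> V \<pi>
    using V(1,2)
    by (intro amalgam_quotient.intro amalgam_axioms amalgam_quotient_axioms.intro)
      (auto simp: finite_p_group_def)
  have detect: "c \<otimes>\<^bsub>G\<^esub> y = y \<otimes>\<^bsub>G\<^esub> cls wa"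
    if c: "c \<in> carrier G" "y \<in> carrier G" "f c y \<in> S" "\<pi> c \<otimes>\<^bsub>V\<^esub> \<pi> y = \<pi> y \<otimes>\<^bsub>V\<^esub> \<pi> (cls wa)" for c y
  proof -
    have "\<pi> (f c y) = inv\<^bsub>V\<^esub> (\<pi> y \<otimes>\<^bsub>V\<^esub> \<pi> (cls wa)) \<otimes>\<^bsub>V\<^esub> (\<pi> c \<otimes>\<^bsub>V\<^esub> \<pi> y)"
      using c ab by (simp add: f_def)
    also have "\<dots> = \<one>\<^bsub>V\<^esub>" unfolding c(4) using c ab by (intro Q.V.l_inv) simp
    finally have "f c y = \<one>\<^bsub>G\<^esub>" using V(3) c(3) by blast
    then show ?thesis
      using c ab G.inv_solve_left'[of "\<one>\<^bsub>G\<^esub>" "y \<otimes>\<^bsub>G\<^esub> cls wa" "c \<otimes>\<^bsub>G\<^esub> y"] by (simp add: f_def)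
  qed
  show ?thesis
  proof (rule Q.p_separated_cyclically_reduced[OF p V(1) waL _ _ wb])
    show "wa \<noteq> []" "\<not> isl (last wa)" using wa by (auto simp: cyclically_reduced_def)
  next
    fix u k v \<alpha> assume u: "wa = u @ Inr k # v" "\<alpha> \<in> A"
    let ?y = "cls (u @ [Inl \<alpha>])"
    have y: "?y \<in> Y wa" using memY[OF u(2)] u(1) by simp
    show "Q.val wa \<otimes>\<^bsub>V\<^esub> Q.val (u @ [Inl \<alpha>]) \<noteq> Q.val (u @ [Inl \<alpha>]) \<otimes>\<^bsub>V\<^esub> Q.val wa"
    proof
      assume "Q.val wa \<otimes>\<^bsub>V\<^esub> Q.val (u @ [Inl \<alpha>]) = Q.val (u @ [Inl \<alpha>]) \<otimes>\<^bsub>V\<^esub> Q.val wa"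
      then have "cls wa \<otimes>\<^bsub>G\<^esub> ?y = ?y \<otimes>\<^bsub>G\<^esub> cls wa"
        using y subY[OF waL y] ab by (intro detect) (auto simp: S_def Q.val_def)
      then show False using cyclically_reduced_centralizer[OF wa u] by simp
    qed
  next
    fix u v \<alpha> assume u: "wb = u @ v" "\<alpha> \<in> A"
    let ?y = "cls (u @ [Inl \<alpha>])"
    have y: "?y \<in> Y wb" using memY[OF u(2)] u(1) by simp
    have yG: "?y \<in> carrier G" by (rule subY[OF wb y])
    show "Q.val wb \<otimes>\<^bsub>V\<^esub> Q.val (u @ [Inl \<alpha>]) \<noteq> Q.val (u @ [Inl \<alpha>]) \<otimes>\<^bsub>V\<^esub> Q.val wa"
    proof
      assume "Q.val wb \<otimes>\<^bsub>V\<^esub> Q.val (u @ [Inl \<alpha>]) = Q.val (u @ [Inl \<alpha>]) \<otimes>\<^bsub>V\<^esub> Q.val wa"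
      then have "cls wb \<otimes>\<^bsub>G\<^esub> ?y = ?y \<otimes>\<^bsub>G\<^esub> cls wa"
        using y yG ab by (intro detect) (auto simp: S_def Q.val_def)
      then have "cls wa = inv\<^bsub>G\<^esub> ?y \<otimes>\<^bsub>G\<^esub> cls wb \<otimes>\<^bsub>G\<^esub> ?y"
        using yG ab G.inv_solve_left[of "cls wa" ?y "cls wb \<otimes>\<^bsub>G\<^esub> ?y"] by (simp add: G.m_assoc)
      then have "conjugate_in G (cls wb) (cls wa)" using yG unfolding conjugate_in_def by blast
      then show False using conjugate_in_sym[OF group_G ab(2)] nc by blast
    qed
  qed
qed

text \<open>Separation is symmetric and invariant under conjugation, so each element may be replaced
  by a letter or a cyclically reduced word. One cyclically reduced word among the two suffices for
  \<open>red\<close>; two letters are left to the factor case.\<close>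

lemma residually_p_imp_p_separated:
  assumes p: "Factorial_Ring.prime (p :: nat)" and res: "residually_p p G"
    and fin: "finite (carrier H)" "finite (carrier K)"
    and ab: "a \<in> carrier G" "b \<in> carrier G" and nc: "\<not> conjugate_in G a b"
  shows "p_separated p G a b"
proof -
  have red: "p_separated p G a b"
    if ab: "a \<in> carrier G" "b \<in> carrier G" and nc: "\<not> conjugate_in G a b"
      and w: "cyclically_reduced w" "conjugate_in G a (cls w)" for a b w
  proof -
    obtain wb where wb: "b = cls wb" "wb \<in> L" using ab by (auto simp: carrier_G)
    have "\<not> conjugate_in G (cls w) (cls wb)"
      using conjugate_in_trans[OF group_G ab(1) w(2)] nc wb(1) by blast
    then have "p_separated p G (cls w) b" using p_separated_reduced[OF p res fin(1) w(1) wb(2)] wb(1) by simp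
    then show ?thesis using p_separated_conjugate[OF group_G _ ab w(2)] by blast
  qed
  show ?thesis
  proof (cases rule: conjugate_cyclically_reduced[OF ab(1)])
    case (2 w)
    then show ?thesis by (rule red[OF ab nc])
  next
    case s: (1 s)
    show ?thesis
    proof (cases rule: conjugate_cyclically_reduced[OF ab(2)])
      case (2 w)
      have "\<not> conjugate_in G b a" using conjugate_in_sym[OF group_G ab(2)] nc by blast
      from red[OF ab(2,1) this 2] show ?thesis by (rule p_separated_sym[OF _ ab(1)])
    next
      case t: (1 t)
      have c: "cls [s] \<in> carrier G" "cls [t] \<in> carrier G" using s t by auto
      have "conjugate_in G (cls [t]) b" using conjugate_in_sym[OF group_G ab(2)] t by blast
      then have "\<not> conjugate_in G (cls [s]) (cls [t])"
        using conjugate_in_trans[OF group_G ab(1) s(2)] conjugate_in_trans[OF group_G ab(1)] nc by blast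
      then have "p_separated p G (cls [s]) (cls [t])" using p_separated_factors[OF p res fin] s t by blast
      then have "p_separated p G a (cls [t])" by (rule p_separated_conjugate[OF group_G _ ab(1) c(2) s(2)])
      then have "p_separated p G (cls [t]) a" by (rule p_separated_sym[OF _ c(2)])
      then have "p_separated p G b a" by (rule p_separated_conjugate[OF group_G _ ab(2,1) t(2)])
      then show ?thesis by (rule p_separated_sym[OF _ ab(1)])
    qed
  qed
qed

end

theorem theorem1:
  fixes p :: nat
    and H :: "'h monoid" and K :: "'k monoid"
    and A :: "'h set" and B :: "'k set" and \<phi> :: "'h \<Rightarrow> 'k"
  assumes "Factorial_Ring.prime p"
    and "finite_p_group p H" and "finite_p_group p K"
    and "subgroup A H" and "subgroup B K"
    and "\<phi> \<in> iso (H\<lparr>carrier := A\<rparr>) (K\<lparr>carrier := B\<rparr>)"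
  shows "conjugacy_p_separable p (amalgamated_product H K A \<phi>) \<longleftrightarrow>
         residually_p p (amalgamated_product H K A \<phi>)"
proof -
  interpret amalgam H K A B \<phi>
    using assms by (intro amalgam.intro) (auto simp: finite_p_group_def)
  have fin: "finite (carrier H)" "finite (carrier K)" using assms by (auto simp: finite_p_group_def)
  show ?thesis
  proof
    assume cps: "conjugacy_p_separable p G"
    show "residually_p p G"
      unfolding residually_p_def
    proof (intro ballI impI)
      fix g assume g: "g \<in> carrier G" "g \<noteq> \<one>\<^bsub>G\<^esub>"
      \<comment> \<open>The identity is conjugate only to itself, so \<open>g\<close> can be
        separated from it.\<close>
      have "\<not> conjugate_in G \<one>\<^bsub>G\<^esub> g"
        using g by (auto simp: conjugate_in_def)
      then obtain Q :: "('h + 'k) list set set monoid" and \<psi> where Q: "finite_p_group p Q" "\<psi> \<in> hom G Q"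
        "\<psi> ` carrier G = carrier Q" "\<not> conjugate_in Q (\<psi> \<one>\<^bsub>G\<^esub>) (\<psi> g)"
        using cps[unfolded conjugacy_p_separable_def, rule_format, OF G.one_closed g(1)] by blast
      have Qg: "group Q" using Q by (simp add: finite_p_group_def)
      have "\<psi> g \<noteq> \<one>\<^bsub>Q\<^esub>"
      proof
        assume "\<psi> g = \<one>\<^bsub>Q\<^esub>"
        then have "conjugate_in Q (\<psi> \<one>\<^bsub>G\<^esub>) (\<psi> g)"
          using conjugate_in_refl[OF Qg group.is_monoid[OF Qg, THEN monoid.one_closed]]
            hom_one[OF Q(2) group_G Qg] by simp
        then show False using Q(4) by contradiction
      qed
      then show "\<exists>(Q :: ('h + 'k) list set set monoid) \<psi>. finite_p_group p Q \<and> \<psi> \<in> hom G Q \<and>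
          \<psi> ` carrier G = carrier Q \<and> \<psi> g \<noteq> \<one>\<^bsub>Q\<^esub>"
        using Q by blast
    qed
  next
    assume "residually_p p G"
    then show "conjugacy_p_separable p G"
      using residually_p_imp_p_separated[OF assms(1) _ fin]
      unfolding conjugacy_p_separable_def p_separated_def by blast
  qed
qed

end
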